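(* Let $G=(V,E)$ be a compact topological packing graph. Then $$\mathrm{las}_{\alpha(G)}(G)=\alpha(G).$$
   Context: Graphs $G=(V,E)$ are undirected and without loops. A clique is a set of vertices in which every two distinct vertices are adjacent; an independent set is a set of vertices containing no edge. The independence number is $\alpha(G)=\sup\{|S|:S\subseteq V\text{ independent}\}$. A graph whose vertex set $V$ is a Hausdorff topological space is a topological packing graph if each finite clique is contained in an open clique (an open subset of $V$ in which every two distinct vertices are adjacent). It is called compact if $V$ is compact; in this case $\alpha(G)$ is finite. For an integer $t\ge 0$ let $\mathrm{sub}_t(V)$ be the set of subsets of $V$ of cardinality at most $t$. The nonempty ones carry the quotient topology from $V^t$ (product topology) under $(v_1,\dots,v_t)\mapsto\{v_1,\dots,v_t\}$, and $\mathrm{sub}_t(V)$ is the disjoint union of this space with $\{\emptyset\}$ (so $\mathrm{sub}_0(V)=\{\emptyset\}$). Let $I_t\subseteq \mathrm{sub}_t(V)$ be the set of independent sets with at most $t$ elements, with the subspace topology (it is a compact Hausdorff space), and let $I_{=s}$ be the set of independent sets with exactly $s$ elements. For a compact Hausdorff space $X$: $\mathcal{C}(X)$ is the space of continuous real-valued functions on $X$; $\mathcal{M}(X)$ is the space of signed Radon measures on $X$ (the dual of $\mathcal{C}(X)$ with the supremum norm) and $\mathcal{M}(X)_{\ge 0}$ the cone of nonnegative ones; $\mathcal{C}(X\times X)_{\mathrm{sym}}$ is the space of continuous symmetric kernels $K:X\times X\to\mathbb{R}$; $\mathcal{C}(X\times X)_{\succeq 0}$ is the cone of $K\in\mathcal{C}(X\times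 X)_{\mathrm{sym}}$ such that $(K(x_i,x_j))_{i,j=1}^m$ is positive semidefinite for all $m$ and all $x_1,\dots,x_m\in X$; $\mathcal{M}(X\times X)_{\mathrm{sym}}$ is the space of signed Radon measures $\mu$ on $X\times X$ with $\mu(E\times E')=\mu(E'\times E)$ for all Borel sets $E,E'$; and $\mathcal{M}(X\times X)_{\succeq 0}$ is the cone of $\mu\in\mathcal{M}(X\times X)_{\mathrm{sym}}$ with $\int K\,d\mu\ge 0$ for all $K\in\mathcal{C}(X\times X)_{\succeq 0}$. The operator $A_t:\mathcal{C}(I_t\times I_t)_{\mathrm{sym}}\to\mathcal{C}(I_{2t})$ is $A_tK(S)=\sum_{J,J'\in I_t:\,J\cup J'=S}K(J,J')$. It is bounded, and $A_t^*:\mathcal{M}(I_{2t})\to\mathcal{M}(I_t\times I_t)_{\mathrm{sym}}$ is its adjoint: $\int K\,d(A_t^*\lambda)=\int A_tK\,d\lambda$ for all $K$. Define $$\mathrm{las}_t(G)=\sup\{\lambda(I_{=1}):\lambda\in\mathcal{M}(I_{2t})_{\ge 0},\ \lambda(\{\emptyset\})=1,\ A_t^*\lambda\in\mathcal{M}(I_t\times I_t)_{\succeq 0}\}.$$ *)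

theory Defs
  imports "HOL-Analysis.Analysis" "HOL-Library.Extended_Nat"
begin

text \<open>
  A graph on the vertex set \<^term>\<open>topspace X\<close> is given by a topology \<^term>\<open>X\<close> and a set \<^term>\<open>E\<close>
  of edges, each of them a two-element set of vertices. Using an abstract topology, rather than a
  topological type class, admits the empty graph.
\<close>

definition graph :: "'a set \<Rightarrow> 'a set set \<Rightarrow> bool" where
  "graph V E \<longleftrightarrow> (\<forall>e\<in>E. e \<subseteq> V \<and> card e = 2)"

definition clique :: "'a set \<Rightarrow> 'a set set \<Rightarrow> 'a set \<Rightarrow> bool" where
  "clique V E C \<longleftrightarrow> C \<subseteq> V \<and> (\<forall>x\<in>C. \<forall>y\<in>C. x \<noteq> y \<longrightarrow> {x, y} \<in> E)"

definition indep :: "'a set \<Rightarrow> 'a set set \<Rightarrow> 'a set \<Rightarrow> bool" where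
  "indep V E S \<longleftrightarrow> S \<subseteq> V \<and> (\<forall>e\<in>E. \<not> e \<subseteq> S)"

definition indep_number :: "'a set \<Rightarrow> 'a set set \<Rightarrow> enat" where
  "indep_number V E = (SUP S\<in>{S. indep V E S}. if finite S then enat (card S) else \<infinity>)"

definition topological_packing_graph :: "'a topology \<Rightarrow> 'a set set \<Rightarrow> bool" where
  "topological_packing_graph X E \<longleftrightarrow>
     graph (topspace X) E \<and> Hausdorff_space X \<and>
     (\<forall>C. finite C \<and> clique (topspace X) E C \<longrightarrow>
        (\<exists>U. openin X U \<and> clique (topspace X) E U \<and> C \<subseteq> U))"

definition compact_topological_packing_graph :: "'a topology \<Rightarrow> 'a set set \<Rightarrow> bool" where
  "compact_topological_packing_graph X E \<longleftrightarrow>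
     topological_packing_graph X E \<and> compact_space X"


section \<open>Spaces of finite subsets\<close>

definition sub_le :: "nat \<Rightarrow> 'a set \<Rightarrow> 'a set set" where
  "sub_le t V = {S. S \<subseteq> V \<and> finite S \<and> card S \<le> t}"

text \<open>
  The final topology on \<^term>\<open>sub_le t (topspace X)\<close> with respect to the map
  \<^term>\<open>\<lambda>v. v ` {..<t}\<close> on tuples. For \<^term>\<open>t \<ge> 1\<close> the empty set is not in the
  image of this map, so that it becomes an isolated point and the topology is the disjoint union of
  the quotient topology on the nonempty sets with a one-point space. For \<^term>\<open>t = 0\<close> the
  only tuple is the empty one, and the space consists of one point.
\<close>

definition sub_topology :: "nat \<Rightarrow> 'a topology \<Rightarrow> 'a set topology" where
  "sub_topology t X = topology (\<lambda>U. U \<subseteq> sub_le t (topspace X) \<and>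
     openin (product_topology (\<lambda>_. X) {..<t})
       {v \<in> topspace (product_topology (\<lambda>_. X) {..<t}). v ` {..<t} \<in> U})"

lemma openin_sub_topology:
  "openin (sub_topology t X) U \<longleftrightarrow> U \<subseteq> sub_le t (topspace X) \<and>
     openin (product_topology (\<lambda>_. X) {..<t})
       {v \<in> topspace (product_topology (\<lambda>_. X) {..<t}). v ` {..<t} \<in> U}"
proof -
  let ?P = "product_topology (\<lambda>_. X) {..<t}"
  let ?pre = "\<lambda>U. {v \<in> topspace ?P. v ` {..<t} \<in> U}"
  have "istopology (\<lambda>U. U \<subseteq> sub_le t (topspace X) \<and> openin ?P (?pre U))"
    unfolding istopology_def
  proof (intro conjI allI impI)
    fix S T assume "S \<subseteq> sub_le t (topspace X) \<and> openin ?P (?pre S)"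
      and "T \<subseteq> sub_le t (topspace X) \<and> openin ?P (?pre T)"
    then have *: "S \<inter> T \<subseteq> sub_le t (topspace X)" "openin ?P (?pre S \<inter> ?pre T)" by auto
    have "?pre S \<inter> ?pre T = ?pre (S \<inter> T)" by auto
    with * show "S \<inter> T \<subseteq> sub_le t (topspace X)" "openin ?P (?pre (S \<inter> T))" by simp_all
  next
    fix K assume K: "\<forall>S\<in>K. S \<subseteq> sub_le t (topspace X) \<and> openin ?P (?pre S)"
    then show "\<Union>K \<subseteq> sub_le t (topspace X)" by blast
    have "openin ?P (\<Union>S\<in>K. ?pre S)" using K by (intro openin_Union) auto
    moreover have "(\<Union>S\<in>K. ?pre S) = ?pre (\<Union>K)" by auto
    ultimately show "openin ?P (?pre (\<Union>K))" by simp
  qed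
  then show ?thesis by (simp add: sub_topology_def topology_inverse')
qed

lemma topspace_sub_topology: "topspace (sub_topology t X) = sub_le t (topspace X)"
proof -
  let ?P = "product_topology (\<lambda>_. X) {..<t}"
  have "v ` {..<t} \<in> sub_le t (topspace X)" if "v \<in> topspace ?P" for v
    using that card_image_le[of "{..<t}" v] by (auto simp: sub_le_def PiE_def Pi_def)
  then have "{v \<in> topspace ?P. v ` {..<t} \<in> sub_le t (topspace X)} = topspace ?P" by blast
  then have "openin (sub_topology t X) (sub_le t (topspace X))"
    by (simp only: openin_sub_topology openin_topspace simp_thms subset_refl)
  then show ?thesis
    by (metis openin_sub_topology openin_subset openin_topspace subset_antisym)
qed

definition indep_le :: "'a topology \<Rightarrow> 'a set set \<Rightarrow> nat \<Rightarrow> 'a set set" where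
  "indep_le X E t = {S \<in> sub_le t (topspace X). indep (topspace X) E S}"

definition indep_eq :: "'a topology \<Rightarrow> 'a set set \<Rightarrow> nat \<Rightarrow> 'a set set" where
  "indep_eq X E s = {S. indep (topspace X) E S \<and> finite S \<and> card S = s}"

definition indep_space :: "'a topology \<Rightarrow> 'a set set \<Rightarrow> nat \<Rightarrow> 'a set topology" where
  "indep_space X E t = subtopology (sub_topology t X) (indep_le X E t)"


section \<open>Signed Radon measures\<close>

definition borel_sets :: "'a topology \<Rightarrow> 'a set set" where
  "borel_sets X = sigma_sets (topspace X) {U. openin X U}"

text \<open>
  A signed measure is a real-valued set function, by convention zero outside the Borel sets. Its
  upper and lower variations are those of the Jordan decomposition.
\<close>

definition pos_variation :: "'a topology \<Rightarrow> ('a set \<Rightarrow> real) \<Rightarrow> 'a set \<Rightarrow> ennreal" where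
  "pos_variation X \<mu> A = (SUP B\<in>{B \<in> borel_sets X. B \<subseteq> A}. ennreal (\<mu> B))"

definition neg_variation :: "'a topology \<Rightarrow> ('a set \<Rightarrow> real) \<Rightarrow> 'a set \<Rightarrow> ennreal" where
  "neg_variation X \<mu> A = (SUP B\<in>{B \<in> borel_sets X. B \<subseteq> A}. ennreal (- \<mu> B))"

text \<open>
  The last condition is inner regularity of the total variation; for finite measures on a
  Hausdorff space this is the Radon property.
\<close>

definition radon_measures :: "'a topology \<Rightarrow> ('a set \<Rightarrow> real) set" where
  "radon_measures X = {\<mu>.
     (\<forall>A. A \<notin> borel_sets X \<longrightarrow> \<mu> A = 0) \<and>
     (\<forall>A :: nat \<Rightarrow> 'a set. range A \<subseteq> borel_sets X \<and> disjoint_family A \<longrightarrow>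
        (\<lambda>i. \<mu> (A i)) sums \<mu> (\<Union>i. A i)) \<and>
     (\<forall>A\<in>borel_sets X. \<forall>\<epsilon>>0. \<exists>K. compactin X K \<and> K \<in> borel_sets X \<and> K \<subseteq> A \<and>
        pos_variation X \<mu> (A - K) + neg_variation X \<mu> (A - K) < ennreal \<epsilon>)}"

definition nonneg_radon_measures :: "'a topology \<Rightarrow> ('a set \<Rightarrow> real) set" where
  "nonneg_radon_measures X = {\<mu> \<in> radon_measures X. \<forall>A\<in>borel_sets X. 0 \<le> \<mu> A}"

definition radon_integral :: "'a topology \<Rightarrow> ('a set \<Rightarrow> real) \<Rightarrow> ('a \<Rightarrow> real) \<Rightarrow> real" where
  "radon_integral X \<mu> f =
     integral\<^sup>L (measure_of (topspace X) (borel_sets X) (pos_variation X \<mu>)) f -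
     integral\<^sup>L (measure_of (topspace X) (borel_sets X) (neg_variation X \<mu>)) f"


section \<open>Kernels and positive semidefiniteness\<close>

definition sym_kernels :: "'a topology \<Rightarrow> ('a \<times> 'a \<Rightarrow> real) set" where
  "sym_kernels X = {K. continuous_map (prod_topology X X) euclideanreal K \<and>
     (\<forall>x\<in>topspace X. \<forall>y\<in>topspace X. K (x, y) = K (y, x))}"

definition psd_kernels :: "'a topology \<Rightarrow> ('a \<times> 'a \<Rightarrow> real) set" where
  "psd_kernels X = {K \<in> sym_kernels X.
     \<forall>(m :: nat) (x :: nat \<Rightarrow> 'a). (\<forall>i<m. x i \<in> topspace X) \<longrightarrow>
       (\<forall>c :: nat \<Rightarrow> real. 0 \<le> (\<Sum>i<m. \<Sum>j<m. c i * K (x i, x j) * c j))}"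

definition sym_measures :: "'a topology \<Rightarrow> (('a \<times> 'a) set \<Rightarrow> real) set" where
  "sym_measures X = {\<mu> \<in> radon_measures (prod_topology X X).
     \<forall>A\<in>borel_sets X. \<forall>B\<in>borel_sets X. \<mu> (A \<times> B) = \<mu> (B \<times> A)}"

definition psd_measures :: "'a topology \<Rightarrow> (('a \<times> 'a) set \<Rightarrow> real) set" where
  "psd_measures X = {\<mu> \<in> sym_measures X.
     \<forall>K\<in>psd_kernels X. 0 \<le> radon_integral (prod_topology X X) \<mu> K}"


section \<open>The Lasserre hierarchy\<close>

definition A_op ::
  "'a topology \<Rightarrow> 'a set set \<Rightarrow> nat \<Rightarrow> ('a set \<times> 'a set \<Rightarrow> real) \<Rightarrow> 'a set \<Rightarrow> real" where
  "A_op X E t K S =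
     (\<Sum>(J, J') \<in> {(J, J'). J \<in> indep_le X E t \<and> J' \<in> indep_le X E t \<and> J \<union> J' = S}. K (J, J'))"

text \<open>
  \<^term>\<open>is_A_adjoint X E t \<nu> \<mu>\<close> says that \<^term>\<open>\<mu>\<close> is the image of \<^term>\<open>\<nu>\<close> under the adjoint of
  \<^term>\<open>A_op X E t\<close>. For a compact topological packing graph the Riesz representation theorem yields
  exactly one such \<^term>\<open>\<mu>\<close> for every \<^term>\<open>\<nu> \<in> radon_measures (indep_space X E (2 * t))\<close>.
\<close>

definition is_A_adjoint :: "'a topology \<Rightarrow> 'a set set \<Rightarrow> nat \<Rightarrow>
    ('a set set \<Rightarrow> real) \<Rightarrow> (('a set \<times> 'a set) set \<Rightarrow> real) \<Rightarrow> bool" where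
  "is_A_adjoint X E t \<nu> \<mu> \<longleftrightarrow>
     \<mu> \<in> sym_measures (indep_space X E t) \<and>
     (\<forall>K\<in>sym_kernels (indep_space X E t).
        radon_integral (prod_topology (indep_space X E t) (indep_space X E t)) \<mu> K =
        radon_integral (indep_space X E (2 * t)) \<nu> (A_op X E t K))"

definition las_feasible :: "'a topology \<Rightarrow> 'a set set \<Rightarrow> nat \<Rightarrow> ('a set set \<Rightarrow> real) set" where
  "las_feasible X E t = {\<nu> \<in> nonneg_radon_measures (indep_space X E (2 * t)).
     \<nu> {{}} = 1 \<and> (\<exists>\<mu>. is_A_adjoint X E t \<nu> \<mu> \<and> \<mu> \<in> psd_measures (indep_space X E t))}"

definition las :: "'a topology \<Rightarrow> 'a set set \<Rightarrow> nat \<Rightarrow> ereal" where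
  "las X E t = (SUP \<nu>\<in>las_feasible X E t. ereal (\<nu> (indep_eq X E 1)))"

end

theory Submission
  imports Defs
begin

text \<open>
  Let \<open>\<alpha>\<close> be the independence number. For an independent set \<open>S\<close> the number
  \<open>\<alpha> - |S|\<close> is the sum over \<open>s \<le> \<alpha>\<close> of \<open>(\<alpha> - s) [|S| = s]\<^sup>2\<close>, and
  \<open>[|S| = s]\<close> is a combination of the indicators of \<open>J \<subseteq> S\<close> whose coefficients depend only
  on \<open>|J|\<close>. This turns \<open>\<alpha> - |S|\<close> into a positive semidefinite kernel \<open>K(J, J')\<close> that depends
  only on \<open>|J|\<close> and \<open>|J'|\<close>. It is continuous since the cardinality is locally constant on
  independent sets, and its image under the operator is \<open>\<alpha>\<close> at the empty set,
  \<open>-1\<close> at singletons and \<open>0\<close> elsewhere. Integrating it gives \<open>\<lambda>(I\<^sub>=\<^sub>1) \<le> \<alpha>\<close> for every feasible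
  \<open>\<lambda>\<close>. Conversely, for a maximum independent set \<open>S\<close> the sum of the point masses at the subsets of
  \<open>S\<close> is feasible, because its image under the adjoint is a product measure.
\<close>

section \<open>Borel sets and nonnegative Radon measures\<close>

lemma sigma_algebra_borel_sets: "sigma_algebra (topspace Y) (borel_sets Y)"
  unfolding borel_sets_def by (rule sigma_algebra_sigma_sets) (auto dest: openin_subset)

lemma borel_sets_subset: "A \<in> borel_sets Y \<Longrightarrow> A \<subseteq> topspace Y"
  using sigma_algebra_borel_sets[of Y]
  by (meson algebra.axioms(1) ring_of_sets.axioms(1) semiring_of_sets.axioms(1)
      sigma_algebra.axioms(1) subset_class.sets_into_space)

lemma openin_borel_sets: "openin Y U \<Longrightarrow> U \<in> borel_sets Y"
  unfolding borel_sets_def by (rule sigma_sets.Basic) simp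

lemma closedin_borel_sets: "closedin Y C \<Longrightarrow> C \<in> borel_sets Y"
proof -
  assume C: "closedin Y C"
  interpret sigma_algebra "topspace Y" "borel_sets Y" by (rule sigma_algebra_borel_sets)
  have "topspace Y - (topspace Y - C) \<in> borel_sets Y"
    using C by (intro compl_sets openin_borel_sets) auto
  then show ?thesis using closedin_subset[OF C] by (simp add: double_diff)
qed

lemma finite_borel_sets:
  assumes "t1_space Y" "finite A" "A \<subseteq> topspace Y"
  shows "A \<in> borel_sets Y"
  using assms by (intro closedin_borel_sets) (simp add: t1_space_closedin_finite)

lemma vimage_borel_sets:
  assumes f: "continuous_map Y Z f" and "B \<in> borel_sets Z"
  shows "f -` B \<inter> topspace Y \<in> borel_sets Y"
proof -
  interpret sigma_algebra "topspace Y" "borel_sets Y" by (rule sigma_algebra_borel_sets)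
  have funcset: "f ` topspace Y \<subseteq> topspace Z" using f by (rule continuous_map_image_subset_topspace)
  show ?thesis
    using assms(2) unfolding borel_sets_def[of Z]
  proof (induction rule: sigma_sets.induct)
    case (Basic a)
    then have "openin Y {x \<in> topspace Y. f x \<in> a}"
      using f by (auto intro: openin_continuous_map_preimage)
    moreover have "{x \<in> topspace Y. f x \<in> a} = f -` a \<inter> topspace Y" by auto
    ultimately show ?case using openin_borel_sets by metis
  next
    case Empty
    show ?case by simp
  next
    case (Compl a)
    have "f -` (topspace Z - a) \<inter> topspace Y = topspace Y - (f -` a \<inter> topspace Y)"
      using funcset by auto
    then show ?case using compl_sets[OF Compl.IH] by simp
  next
    case (Union a)
    have "f -` (\<Union>i. a i) \<inter> topspace Y = (\<Union>i. f -` a i \<inter> topspace Y)" by auto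
    moreover have "(\<Union>i. f -` a i \<inter> topspace Y) \<in> borel_sets Y"
      using Union.IH by (intro countable_UN) auto
    ultimately show ?case by metis
  qed
qed

lemma Times_borel_sets:
  assumes "A \<in> borel_sets Y" "B \<in> borel_sets Z"
  shows "A \<times> B \<in> borel_sets (prod_topology Y Z)"
proof -
  let ?P = "prod_topology Y Z"
  interpret sigma_algebra "topspace ?P" "borel_sets ?P" by (rule sigma_algebra_borel_sets)
  have "A \<times> B = (fst -` A \<inter> topspace ?P) \<inter> (snd -` B \<inter> topspace ?P)"
    using borel_sets_subset[OF assms(1)] borel_sets_subset[OF assms(2)] by auto
  then show ?thesis
    using vimage_borel_sets[OF continuous_map_fst assms(1)]
      vimage_borel_sets[OF continuous_map_snd assms(2)]
    by (metis Int)
qed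

lemma borel_measurable_continuous_map:
  assumes "continuous_map Y euclideanreal f" and "space M = topspace Y" "sets M = borel_sets Y"
  shows "f \<in> borel_measurable M"
proof (rule borel_measurableI)
  fix U :: "real set" assume "open U"
  then have "U \<in> borel_sets euclideanreal" by (simp add: openin_borel_sets)
  then show "f -` U \<inter> space M \<in> sets M"
    using vimage_borel_sets[OF assms(1)] assms(2,3) by simp
qed

text \<open>This is the measure in the first term of \<open>radon_integral\<close>. For nonnegative
  \<open>\<mu>\<close> it is \<open>\<mu>\<close> itself, packaged so that Lebesgue integration
  applies.\<close>

definition radon_measure :: "'a topology \<Rightarrow> ('a set \<Rightarrow> real) \<Rightarrow> 'a measure" where
  "radon_measure Y \<mu> = measure_of (topspace Y) (borel_sets Y) (pos_variation Y \<mu>)"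

lemma space_radon_measure [simp]: "space (radon_measure Y \<mu>) = topspace Y"
  unfolding radon_measure_def
  by (rule space_measure_of) (auto dest: borel_sets_subset)

lemma sets_radon_measure [simp]: "sets (radon_measure Y \<mu>) = borel_sets Y"
proof -
  have "sets (radon_measure Y \<mu>) = sigma_sets (topspace Y) (borel_sets Y)"
    unfolding radon_measure_def by (rule sets_measure_of) (auto dest: borel_sets_subset)
  also have "\<dots> = borel_sets Y"
    using sigma_algebra.sigma_sets_eq[OF sigma_algebra_borel_sets] .
  finally show ?thesis .
qed

text \<open>Countable additivity along the constant sequence \<open>{}\<close> makes a series with
  constant terms converge, which forces the term to be zero.\<close>

lemma radon_measures_empty:
  assumes "\<mu> \<in> radon_measures Y"
  shows "\<mu> {} = 0"
proof -
  interpret sigma_algebra "topspace Y" "borel_sets Y" by (rule sigma_algebra_borel_sets)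
  have "(\<lambda>i::nat. \<mu> {}) sums \<mu> (\<Union>i::nat. {})"
    using assms[unfolded radon_measures_def, simplified, THEN conjunct2, THEN conjunct1,
        rule_format, of "\<lambda>_. {}"]
    by (simp add: disjoint_family_on_def image_subset_iff)
  then show ?thesis using sums_summable summable_const_iff by blast
qed

lemma radon_measures_sums:
  assumes "\<mu> \<in> radon_measures Y" "range A \<subseteq> borel_sets Y" "disjoint_family A"
  shows "(\<lambda>i::nat. \<mu> (A i)) sums \<mu> (\<Union>i. A i)"
  using assms by (simp add: radon_measures_def)

lemma radon_measures_Un:
  assumes "\<mu> \<in> radon_measures Y" "A \<in> borel_sets Y" "B \<in> borel_sets Y" "A \<inter> B = {}"
  shows "\<mu> (A \<union> B) = \<mu> A + \<mu> B"
proof -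
  interpret sigma_algebra "topspace Y" "borel_sets Y" by (rule sigma_algebra_borel_sets)
  have "(\<lambda>i. \<mu> (binaryset A B i)) sums \<mu> (\<Union>i. binaryset A B i)"
    using assms
    by (intro radon_measures_sums)
       (auto simp: range_binaryset_eq disjoint_family_on_def binaryset_def)
  moreover have "(\<lambda>i. \<mu> (binaryset A B i)) sums (\<mu> A + \<mu> B)"
    by (rule binaryset_sums) (rule radon_measures_empty[OF assms(1)])
  ultimately show ?thesis by (metis UN_binaryset_eq sums_unique2)
qed

lemma nonneg_radon_measures_mono:
  assumes "\<mu> \<in> nonneg_radon_measures Y" "A \<in> borel_sets Y" "B \<in> borel_sets Y" "A \<subseteq> B"
  shows "\<mu> A \<le> \<mu> B"
proof -
  interpret sigma_algebra "topspace Y" "borel_sets Y" by (rule sigma_algebra_borel_sets)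
  have "B - A \<in> borel_sets Y" using assms by auto
  then have "0 \<le> \<mu> (B - A)" using assms by (simp add: nonneg_radon_measures_def)
  moreover have "\<mu> (A \<union> (B - A)) = \<mu> A + \<mu> (B - A)"
    using assms \<open>B - A \<in> borel_sets Y\<close>
    by (intro radon_measures_Un[of \<mu> Y]) (auto simp: nonneg_radon_measures_def)
  moreover have "A \<union> (B - A) = B" using assms by auto
  ultimately show ?thesis by simp
qed

text \<open>By monotonicity \<open>B = A\<close> gives the largest term of the supremum.\<close>

lemma pos_variation_nonneg:
  assumes "\<And>A B. A \<in> borel_sets Y \<Longrightarrow> B \<in> borel_sets Y \<Longrightarrow> A \<subseteq> B \<Longrightarrow> \<mu> A \<le> \<mu> B"
    and "A \<in> borel_sets Y"
  shows "pos_variation Y \<mu> A = ennreal (\<mu> A)"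
  unfolding pos_variation_def using assms
  by (intro antisym SUP_least SUP_upper) (auto intro: ennreal_leI)

text \<open>\<open>ennreal\<close> truncates negative reals to 0, so every term of the supremum
  vanishes, even when \<open>A\<close> itself is not Borel.\<close>

lemma neg_variation_nonneg:
  assumes "\<And>A. A \<in> borel_sets Y \<Longrightarrow> 0 \<le> \<mu> A"
  shows "neg_variation Y \<mu> = (\<lambda>_. 0)"
proof
  fix A
  have "neg_variation Y \<mu> A \<le> 0"
    unfolding neg_variation_def using assms by (intro SUP_least) (simp add: ennreal_neg)
  then show "neg_variation Y \<mu> A = 0" by simp
qed

text \<open>On Borel sets the upper variation agrees with \<open>\<mu>\<close>, so it inherits
  countable additivity from the convergent real series, and \<open>measure_of\<close> returns it
  unchanged.\<close>

lemma emeasure_radon_measure: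
  assumes \<mu>: "\<mu> \<in> nonneg_radon_measures Y" and "A \<in> borel_sets Y"
  shows "emeasure (radon_measure Y \<mu>) A = ennreal (\<mu> A)"
proof -
  interpret sigma_algebra "topspace Y" "borel_sets Y" by (rule sigma_algebra_borel_sets)
  have \<mu>': "\<mu> \<in> radon_measures Y" and nonneg: "\<And>A. A \<in> borel_sets Y \<Longrightarrow> 0 \<le> \<mu> A"
    using \<mu> by (auto simp: nonneg_radon_measures_def)
  have pv: "pos_variation Y \<mu> B = ennreal (\<mu> B)" if "B \<in> borel_sets Y" for B
    using nonneg_radon_measures_mono[OF \<mu>] that by (intro pos_variation_nonneg) auto
  have "emeasure (radon_measure Y \<mu>) A = pos_variation Y \<mu> A"
    unfolding radon_measure_def
  proof (rule emeasure_measure_of[OF refl])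
    show "borel_sets Y \<subseteq> Pow (topspace Y)" by (auto dest: borel_sets_subset)
    have sets: "sets (measure_of (topspace Y) (borel_sets Y) (pos_variation Y \<mu>)) = borel_sets Y"
      using sets_radon_measure[of Y \<mu>] by (simp add: radon_measure_def)
    show "A \<in> sets (measure_of (topspace Y) (borel_sets Y) (pos_variation Y \<mu>))"
      using assms(2) sets by simp
    show "positive (sets (measure_of (topspace Y) (borel_sets Y) (pos_variation Y \<mu>)))
      (pos_variation Y \<mu>)"
      using pv[of "{}"] radon_measures_empty[OF \<mu>'] by (simp add: positive_def)
    show "countably_additive (sets (measure_of (topspace Y) (borel_sets Y) (pos_variation Y \<mu>)))
      (pos_variation Y \<mu>)"
      unfolding sets countably_additive_def
    proof (intro allI impI)
      fix B :: "nat \<Rightarrow> 'a set"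
      assume B: "range B \<subseteq> borel_sets Y" "disjoint_family B" "\<Union> (range B) \<in> borel_sets Y"
      have s: "(\<lambda>i. \<mu> (B i)) sums \<mu> (\<Union>i. B i)" using radon_measures_sums[OF \<mu>'] B by simp
      have "(\<Sum>i. pos_variation Y \<mu> (B i)) = (\<Sum>i. ennreal (\<mu> (B i)))"
        using B by (intro suminf_cong pv) auto
      also have "\<dots> = ennreal (\<Sum>i. \<mu> (B i))"
        using B s by (intro suminf_ennreal2 nonneg) (auto simp: sums_summable)
      also have "\<dots> = pos_variation Y \<mu> (\<Union> (range B))"
        using s pv[OF B(3)] by (simp add: sums_iff)
      finally show "(\<Sum>i. pos_variation Y \<mu> (B i)) = pos_variation Y \<mu> (\<Union> (range B))" .
    qed
  qed
  then show ?thesis using pv[OF assms(2)] by simp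
qed

lemma radon_integral_nonneg_eq:
  assumes "\<mu> \<in> nonneg_radon_measures Y"
  shows "radon_integral Y \<mu> f = integral\<^sup>L (radon_measure Y \<mu>) f"
proof -
  let ?N = "measure_of (topspace Y) (borel_sets Y) (\<lambda>_. 0::ennreal)"
  have "neg_variation Y \<mu> = (\<lambda>_. 0)"
    using assms by (intro neg_variation_nonneg) (auto simp: nonneg_radon_measures_def)
  \<comment> \<open>The lower variation is identically zero, so the subtracted integral is taken
    against a null measure.\<close>
  moreover have "?N = null_measure ?N"
    by (intro measure_eqI) (simp_all add: emeasure_sigma)
  then have "integral\<^sup>L ?N f = 0"
    by (metis integral_null_measure)
  ultimately show ?thesis
    by (simp add: radon_integral_def radon_measure_def)
qed

text \<open>Reduces integrals of step functions to values of \<open>\<mu>\<close>. Agreement on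
  \<open>topspace Y\<close> suffices, as this is the space of the measure.\<close>

lemma radon_integral_indicator:
  assumes "\<mu> \<in> nonneg_radon_measures Y" "finite I" "\<And>i. i \<in> I \<Longrightarrow> A i \<in> borel_sets Y"
    and "\<And>x. x \<in> topspace Y \<Longrightarrow> f x = (\<Sum>i\<in>I. c i * indicator (A i) x)"
  shows "radon_integral Y \<mu> f = (\<Sum>i\<in>I. c i * \<mu> (A i))"
proof -
  let ?M = "radon_measure Y \<mu>"
  have em: "emeasure ?M (A i) = ennreal (\<mu> (A i))" and me: "measure ?M (A i) = \<mu> (A i)"
    if "i \<in> I" for i
    using emeasure_radon_measure[OF assms(1) assms(3)[OF that]] assms(1) assms(3)[OF that]
    by (auto simp: measure_def nonneg_radon_measures_def)
  have "radon_integral Y \<mu> f = (\<integral>x. (\<Sum>i\<in>I. c i * indicator (A i) x) \<partial>?M)"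
    unfolding radon_integral_nonneg_eq[OF assms(1)]
    using assms(4) by (intro Bochner_Integration.integral_cong) auto
  also have "\<dots> = (\<Sum>i\<in>I. \<integral>x. c i * indicator (A i) x \<partial>?M)"
    using assms(3) em
    by (intro Bochner_Integration.integral_sum integrable_mult_right integrable_real_indicator) auto
  also have "\<dots> = (\<Sum>i\<in>I. c i * \<mu> (A i))"
    using me assms(3) by (intro sum.cong refl) (simp add: Int_absorb2 borel_sets_subset)
  finally show ?thesis .
qed


section \<open>Finite sums of point masses\<close>

text \<open>The value 0 off the Borel sets is the convention required by
  \<open>radon_measures\<close>.\<close>

definition counting :: "'a topology \<Rightarrow> 'a set \<Rightarrow> 'a set \<Rightarrow> real" where
  "counting Y F A = (if A \<in> borel_sets Y then \<Sum>x\<in>F. indicator A x else 0)"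

lemma counting_eq_card:
  assumes "finite F" "A \<in> borel_sets Y"
  shows "counting Y F A = real (card (A \<inter> F))"
  using assms by (simp add: counting_def indicator_def sum.If_cases Int_commute Int_def)

text \<open>For inner regularity of \<open>A\<close> take the finite set
  \<open>A \<inter> F\<close>: it is compact, and Borel by T1, and the rest of \<open>A\<close>
  misses \<open>F\<close> and so has variation zero.\<close>

lemma counting_nonneg_radon:
  assumes Y: "t1_space Y" and F: "finite F" "F \<subseteq> topspace Y"
  shows "counting Y F \<in> nonneg_radon_measures Y"
proof -
  interpret sigma_algebra "topspace Y" "borel_sets Y" by (rule sigma_algebra_borel_sets)
  have nonneg: "0 \<le> counting Y F A" for A
    by (simp add: counting_def sum_nonneg)
  have mono: "counting Y F A \<le> counting Y F B"
    if "A \<in> borel_sets Y" "B \<in> borel_sets Y" "A \<subseteq> B" for A B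
    using that F(1) by (simp add: counting_eq_card) (meson Int_mono card_mono finite_Int order_refl)
  have "(\<lambda>i. counting Y F (A i)) sums counting Y F (\<Union>i. A i)"
    if A: "range A \<subseteq> borel_sets Y" "disjoint_family A" for A :: "nat \<Rightarrow> 'a set"
  proof -
    have "(\<lambda>i. \<Sum>x\<in>F. indicator (A i) x :: real) sums (\<Sum>x\<in>F. indicator (\<Union>i. A i) x)"
      using A(2) by (intro sums_sum indicator_sums) (auto simp: disjoint_family_on_def)
    moreover have "(\<Union>i. A i) \<in> borel_sets Y" "\<And>i. A i \<in> borel_sets Y" using A by auto
    ultimately show ?thesis by (simp add: counting_def)
  qed
  moreover have "\<exists>K. compactin Y K \<and> K \<in> borel_sets Y \<and> K \<subseteq> A \<and>
      pos_variation Y (counting Y F) (A - K) + neg_variation Y (counting Y F) (A - K) < ennreal \<epsilon>"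
    if "A \<in> borel_sets Y" "\<epsilon> > 0" for A \<epsilon>
  proof (intro exI conjI)
    have AF: "A \<inter> F \<subseteq> topspace Y" using F by auto
    show "compactin Y (A \<inter> F)" using F AF by (intro finite_imp_compactin) auto
    show bor: "A \<inter> F \<in> borel_sets Y" using Y F AF by (intro finite_borel_sets) auto
    have D: "A - A \<inter> F \<in> borel_sets Y" using that bor by auto
    have "(A - A \<inter> F) \<inter> F = {}" by auto
    then have "counting Y F (A - A \<inter> F) = 0" using counting_eq_card[OF F(1) D] by simp
    moreover have "pos_variation Y (counting Y F) (A - A \<inter> F)
        = ennreal (counting Y F (A - A \<inter> F))"
      by (rule pos_variation_nonneg[OF mono D])
    moreover have "neg_variation Y (counting Y F) = (\<lambda>_. 0)"
      by (rule neg_variation_nonneg[OF nonneg])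
    ultimately show "pos_variation Y (counting Y F) (A - A \<inter> F)
        + neg_variation Y (counting Y F) (A - A \<inter> F) < ennreal \<epsilon>"
      using that by simp
  qed simp
  moreover have "counting Y F A = 0" if "A \<notin> borel_sets Y" for A
    using that by (simp add: counting_def)
  ultimately show ?thesis
    using nonneg by (simp add: nonneg_radon_measures_def radon_measures_def)
qed

text \<open>The complement of \<open>F\<close> is a null set, so \<open>f\<close> agrees almost
  everywhere with a combination of indicators of the points of \<open>F\<close>. Continuity supplies
  measurability of \<open>f\<close>.\<close>

lemma radon_integral_counting:
  assumes Y: "t1_space Y" and F: "finite F" "F \<subseteq> topspace Y"
    and f: "continuous_map Y euclideanreal f"
  shows "radon_integral Y (counting Y F) f = (\<Sum>x\<in>F. f x)"
proof -
  interpret sigma_algebra "topspace Y" "borel_sets Y" by (rule sigma_algebra_borel_sets)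
  let ?M = "radon_measure Y (counting Y F)"
  let ?g = "\<lambda>y. \<Sum>x\<in>F. f x * indicator {x} y"
  note rad = counting_nonneg_radon[OF Y F]
  have FB: "F \<in> borel_sets Y" and sB: "\<And>x. x \<in> F \<Longrightarrow> {x} \<in> borel_sets Y"
    using finite_borel_sets[OF Y] F by auto
  have D: "topspace Y - F \<in> borel_sets Y" using FB by auto
  have "(topspace Y - F) \<inter> F = {}" by auto
  then have "emeasure ?M (topspace Y - F) = 0"
    using emeasure_radon_measure[OF rad D] counting_eq_card[OF F(1) D] by simp
  then have "AE x in ?M. x \<in> F"
    using D by (intro AE_I[of _ _ "topspace Y - F"]) auto
  moreover have "f x = ?g x" if "x \<in> F" for x
    using F that by (simp add: indicator_def if_distrib sum.delta cong: if_cong)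
  ultimately have "AE x in ?M. f x = ?g x" by auto
  then have "integral\<^sup>L ?M f = integral\<^sup>L ?M ?g"
    using sB by (intro integral_cong_AE borel_measurable_continuous_map[OF f] borel_measurable_sum
        borel_measurable_times borel_measurable_indicator) auto
  also have "\<dots> = radon_integral Y (counting Y F) ?g"
    by (simp add: radon_integral_nonneg_eq[OF rad])
  also have "\<dots> = (\<Sum>x\<in>F. f x * counting Y F {x})"
    by (rule radon_integral_indicator[OF rad F(1) sB refl])
  also have "\<dots> = (\<Sum>x\<in>F. f x)"
    using F sB by (intro sum.cong refl) (simp add: counting_eq_card)
  finally show ?thesis by (simp add: radon_integral_nonneg_eq[OF rad])
qed


section \<open>The space of independent sets\<close>

lemma indep_subset: "indep V E S \<Longrightarrow> T \<subseteq> S \<Longrightarrow> indep V E T"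
  unfolding indep_def by blast

lemma indep_le_iff:
  "S \<in> indep_le X E t \<longleftrightarrow> indep (topspace X) E S \<and> finite S \<and> card S \<le> t"
  by (auto simp: indep_le_def sub_le_def indep_def)

lemma indep_eq_subset_indep_le:
  assumes "\<And>T. indep (topspace X) E T \<Longrightarrow> finite T \<and> card T \<le> a" and "a \<le> t"
  shows "indep_eq X E k \<subseteq> indep_le X E t"
proof
  fix T assume "T \<in> indep_eq X E k"
  then show "T \<in> indep_le X E t" using assms(1)[of T] assms(2) by (simp add: indep_eq_def indep_le_iff)
qed

lemma topspace_indep_space [simp]: "topspace (indep_space X E t) = indep_le X E t"
  by (auto simp: indep_space_def topspace_sub_topology indep_le_def)

text \<open>The tuples with image \<open>R\<close> have all coordinates in the finite set
  \<open>R\<close>. There are finitely many of them, so they form a closed set in the T1 product. T1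
  is what makes finite sets Borel later on.\<close>

lemma t1_space_sub_topology:
  assumes "Hausdorff_space X"
  shows "t1_space (sub_topology t X)"
  unfolding t1_space_closedin_singleton
proof
  fix R assume R: "R \<in> topspace (sub_topology t X)"
  let ?P = "product_topology (\<lambda>_. X) {..<t}"
  let ?F = "{v \<in> topspace ?P. v ` {..<t} = R}"
  have R': "R \<in> sub_le t (topspace X)" "finite R"
    using R by (auto simp: topspace_sub_topology sub_le_def)
  have "?F \<subseteq> PiE {..<t} (\<lambda>_. R)" by (auto simp: PiE_def)
  then have "finite ?F" by (rule finite_subset) (use R' in \<open>auto intro: finite_PiE\<close>)
  moreover have "t1_space ?P"
    using assms by (simp add: t1_space_product_topology Hausdorff_imp_t1_space)
  ultimately have "closedin ?P ?F" by (auto simp: t1_space_closedin_finite)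
  then have "openin ?P (topspace ?P - ?F)" by blast
  moreover have "topspace ?P - ?F
      = {v \<in> topspace ?P. v ` {..<t} \<in> sub_le t (topspace X) - {R}}"
    using card_image_le[of "{..<t}"] by (auto simp: sub_le_def)
  ultimately have "openin (sub_topology t X) (sub_le t (topspace X) - {R})"
    by (simp add: openin_sub_topology)
  then show "closedin (sub_topology t X) {R}"
    using R' by (simp add: closedin_def topspace_sub_topology)
qed

lemma t1_space_indep_space: "Hausdorff_space X \<Longrightarrow> t1_space (indep_space X E t)"
  unfolding indep_space_def by (intro t1_space_subtopology t1_space_sub_topology)

section \<open>Independent tuples and their coincidence patterns\<close>

definition indep_tuples :: "'a topology \<Rightarrow> 'a set set \<Rightarrow> nat \<Rightarrow> (nat \<Rightarrow> 'a) set" where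
  "indep_tuples X E n = {v \<in> topspace (product_topology (\<lambda>_. X) {..<n}).
     indep (topspace X) E (v ` {..<n})}"

text \<open>Continuity of functions of independent sets is checked on this space of tuples, where
  coordinates are available.\<close>

definition tuple_space :: "'a topology \<Rightarrow> 'a set set \<Rightarrow> nat \<Rightarrow> (nat \<Rightarrow> 'a) topology" where
  "tuple_space X E n = subtopology (product_topology (\<lambda>_. X) {..<n}) (indep_tuples X E n)"

lemma topspace_tuple_space [simp]: "topspace (tuple_space X E n) = indep_tuples X E n"
  by (auto simp: tuple_space_def indep_tuples_def)

lemma indep_tuples_image: "v \<in> indep_tuples X E n \<Longrightarrow> v ` {..<n} \<in> indep_le X E n"
  using card_image_le[of "{..<n}" v] by (simp add: indep_tuples_def indep_le_iff)

lemma indep_tuples_nth: "v \<in> indep_tuples X E n \<Longrightarrow> i < n \<Longrightarrow> v i \<in> topspace X"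
  by (auto simp: indep_tuples_def)

lemma openin_product_coordinate:
  "openin X U \<Longrightarrow> i \<in> I \<Longrightarrow>
    openin (product_topology (\<lambda>_. X) I) {v \<in> topspace (product_topology (\<lambda>_. X) I). v i \<in> U}"
  by (rule openin_continuous_map_preimage[OF continuous_map_product_projection])

lemma openin_tuple_coordinate:
  assumes "openin X U" "i < n"
  shows "openin (tuple_space X E n) {v \<in> indep_tuples X E n. v i \<in> U}"
proof -
  have "openin (tuple_space X E n)
     ({v \<in> topspace (product_topology (\<lambda>_. X) {..<n}). v i \<in> U} \<inter> indep_tuples X E n)"
    unfolding tuple_space_def using assms
    by (intro openin_subtopology_Int openin_product_coordinate) auto
  moreover have "{v \<in> topspace (product_topology (\<lambda>_. X) {..<n}). v i \<in> U} \<inter> indep_tuples X E n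
     = {v \<in> indep_tuples X E n. v i \<in> U}"
    by (auto simp: indep_tuples_def)
  ultimately show ?thesis by simp
qed

text \<open>An edge \<open>{x, y}\<close> inside the image lies in an open clique \<open>U\<close>.
  With disjoint neighbourhoods \<open>A\<close> of \<open>x\<close> and \<open>B\<close> of
  \<open>y\<close>, any two points of \<open>U \<inter> A\<close> and \<open>U \<inter> B\<close>
  are distinct and hence adjacent, so nearby tuples still contain an edge.\<close>

lemma openin_dependent_tuples:
  assumes G: "topological_packing_graph X E"
  shows "openin (product_topology (\<lambda>_. X) {..<n})
    {v \<in> topspace (product_topology (\<lambda>_. X) {..<n}). \<not> indep (topspace X) E (v ` {..<n})}"
    (is "openin ?P ?D")
proof (subst openin_subopen, intro ballI)
  fix v assume v: "v \<in> ?D"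
  then have "v ` {..<n} \<subseteq> topspace X" by (auto simp: PiE_def Pi_def)
  with v obtain e where e: "e \<in> E" "e \<subseteq> v ` {..<n}" by (auto simp: indep_def)
  then have "card e = 2" "e \<subseteq> topspace X"
    using G by (auto simp: topological_packing_graph_def graph_def)
  then obtain x y where xy: "e = {x, y}" "x \<noteq> y" by (auto simp: card_2_iff)
  with e obtain i j where ij: "i < n" "j < n" "v i = x" "v j = y" by auto
  have xyX: "x \<in> topspace X" "y \<in> topspace X" using \<open>e \<subseteq> topspace X\<close> xy by auto
  have "clique (topspace X) E {x, y}"
    using e xy \<open>e \<subseteq> topspace X\<close> by (auto simp: clique_def insert_commute)
  then obtain U where U: "openin X U" "clique (topspace X) E U" "{x, y} \<subseteq> U"
    using G unfolding topological_packing_graph_def by (meson finite.emptyI finite.insertI)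
  obtain A B where AB: "openin X A" "openin X B" "x \<in> A" "y \<in> B" "disjnt A B"
    using G xy xyX unfolding topological_packing_graph_def Hausdorff_space_def by metis
  let ?T = "{w \<in> topspace ?P. w i \<in> U \<inter> A} \<inter> {w \<in> topspace ?P. w j \<in> U \<inter> B}"
  have "openin ?P ?T"
    using U AB ij by (intro openin_Int openin_product_coordinate) auto
  moreover have "v \<in> ?T" using v U AB ij by auto
  moreover have "?T \<subseteq> ?D"
  proof
    fix w assume w: "w \<in> ?T"
    then have "w i \<noteq> w j" using AB by (auto simp: disjnt_iff)
    with w have "{w i, w j} \<in> E" using U by (auto simp: clique_def)
    moreover have "{w i, w j} \<subseteq> w ` {..<n}" using ij by auto
    ultimately have "\<not> indep (topspace X) E (w ` {..<n})" unfolding indep_def by blast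
    then show "w \<in> ?D" using w by blast
  qed
  ultimately show "\<exists>T. openin ?P T \<and> v \<in> T \<and> T \<subseteq> ?D" by blast
qed

text \<open>
  The coincidence pattern of an independent tuple is locally constant: two vertices near a common
  point lie in an open clique, so in an independent set they are equal.
\<close>

lemma openin_tuple_pattern:
  assumes G: "topological_packing_graph X E" and w: "w \<in> indep_tuples X E n"
  shows "openin (tuple_space X E n)
    {v \<in> indep_tuples X E n. \<forall>i<n. \<forall>j<n. v i = v j \<longleftrightarrow> w i = w j}"
proof -
  have eq: "openin (tuple_space X E n) {v \<in> indep_tuples X E n. v i = v j}"
    if ij: "i < n" "j < n" for i j
  proof (subst openin_subopen, intro ballI)
    fix v assume v: "v \<in> {v \<in> indep_tuples X E n. v i = v j}"
    then have vX: "v i \<in> topspace X" using ij indep_tuples_nth by blast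
    then have "clique (topspace X) E {v i}" by (simp add: clique_def)
    then obtain U where U: "openin X U" "clique (topspace X) E U" "v i \<in> U"
      using G by (auto simp: topological_packing_graph_def)
    let ?T = "{v \<in> indep_tuples X E n. v i \<in> U} \<inter> {v \<in> indep_tuples X E n. v j \<in> U}"
    have "openin (tuple_space X E n) ?T"
      using U ij by (intro openin_Int openin_tuple_coordinate)
    moreover have "v \<in> ?T" using v U by auto
    moreover have "u i = u j" if "u \<in> ?T" for u
    proof (rule ccontr)
      assume "u i \<noteq> u j"
      then have "{u i, u j} \<in> E" using U that by (auto simp: clique_def)
      moreover have "{u i, u j} \<subseteq> u ` {..<n}" using ij by auto
      ultimately show False using that by (auto simp: indep_tuples_def indep_def)
    qed
    ultimately show "\<exists>T. openin (tuple_space X E n) T \<and> v \<in> T \<and>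
        T \<subseteq> {v \<in> indep_tuples X E n. v i = v j}" by blast
  qed
  \<comment> \<open>Distinctness persists nearby by the Hausdorff property alone.\<close>
  have neq: "openin (tuple_space X E n) {v \<in> indep_tuples X E n. v i \<noteq> v j}"
    if ij: "i < n" "j < n" for i j
  proof (subst openin_subopen, intro ballI)
    fix v assume v: "v \<in> {v \<in> indep_tuples X E n. v i \<noteq> v j}"
    then have vX: "v i \<in> topspace X" "v j \<in> topspace X" "v i \<noteq> v j"
      using ij indep_tuples_nth by blast+
    obtain A B where AB: "openin X A" "openin X B" "v i \<in> A" "v j \<in> B" "disjnt A B"
      using G vX unfolding topological_packing_graph_def Hausdorff_space_def by metis
    let ?T = "{v \<in> indep_tuples X E n. v i \<in> A} \<inter> {v \<in> indep_tuples X E n. v j \<in> B}"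
    have "openin (tuple_space X E n) ?T"
      using AB ij by (intro openin_Int openin_tuple_coordinate)
    moreover have "v \<in> ?T" using v AB by auto
    moreover have "?T \<subseteq> {v \<in> indep_tuples X E n. v i \<noteq> v j}"
      using AB by (auto simp: disjnt_iff)
    ultimately show "\<exists>T. openin (tuple_space X E n) T \<and> v \<in> T \<and>
        T \<subseteq> {v \<in> indep_tuples X E n. v i \<noteq> v j}" by blast
  qed
  let ?N = "\<lambda>(i, j). {v \<in> indep_tuples X E n. v i = v j \<longleftrightarrow> w i = w j}"
  have "openin (tuple_space X E n) (?N p)" if "p \<in> {..<n} \<times> {..<n}" for p
    using that eq neq by (cases "w (fst p) = w (snd p)") (auto simp: case_prod_unfold)
  \<comment> \<open>For \<open>n = 0\<close> the family of pairs is empty and its intersection is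
    \<open>UNIV\<close>; meeting it with the \<open>topspace\<close> gives the right set in this
    case too.\<close>
  then have "openin (tuple_space X E n)
      (topspace (tuple_space X E n) \<inter> (\<Inter>p\<in>{..<n} \<times> {..<n}. ?N p))"
    by (cases "{..<n} \<times> {..<n} = {}")
       (auto intro!: openin_Int openin_Inter simp del: topspace_tuple_space)
  moreover have "topspace (tuple_space X E n) \<inter> (\<Inter>p\<in>{..<n} \<times> {..<n}. ?N p)
      = {v \<in> indep_tuples X E n. \<forall>i<n. \<forall>j<n. v i = v j \<longleftrightarrow> w i = w j}"
    by auto
  ultimately show ?thesis by simp
qed

text \<open>The classes of tuples with equal pattern form an open cover, so continuity can be
  checked on each class by the pasting lemma. There \<open>f\<close> may be replaced by a formula
  \<open>g\<close> adapted to the pattern of \<open>w\<close>.\<close>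

lemma continuous_map_tuple_space:
  assumes G: "topological_packing_graph X E"
    and loc: "\<And>w. w \<in> indep_tuples X E n \<Longrightarrow> \<exists>g. continuous_map (tuple_space X E n) Z g \<and>
      (\<forall>v\<in>indep_tuples X E n. (\<forall>i<n. \<forall>j<n. v i = v j \<longleftrightarrow> w i = w j) \<longrightarrow> f v = g v)"
  shows "continuous_map (tuple_space X E n) Z f"
proof -
  let ?T = "\<lambda>w. {v \<in> indep_tuples X E n. \<forall>i<n. \<forall>j<n. v i = v j \<longleftrightarrow> w i = w j}"
  have "\<forall>w\<in>indep_tuples X E n. \<exists>g. continuous_map (tuple_space X E n) Z g \<and> (\<forall>v\<in>?T w. f v = g v)"
  proof
    fix w assume "w \<in> indep_tuples X E n"
    from loc[OF this] show "\<exists>g. continuous_map (tuple_space X E n) Z g \<and> (\<forall>v\<in>?T w. f v = g v)"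
      by blast
  qed
  from bchoice[OF this] obtain g where
    g': "\<forall>w\<in>indep_tuples X E n. continuous_map (tuple_space X E n) Z (g w) \<and> (\<forall>v\<in>?T w. f v = g w v)" ..
  have g: "continuous_map (tuple_space X E n) Z (g w)" "v \<in> ?T w \<Longrightarrow> f v = g w v"
    if "w \<in> indep_tuples X E n" for v w
    using bspec[OF g' that] by blast+
  show ?thesis
  proof (rule pasting_lemma[where I = "indep_tuples X E n" and T = ?T and f = g])
    fix w assume w: "w \<in> indep_tuples X E n"
    show "openin (tuple_space X E n) (?T w)" by (rule openin_tuple_pattern[OF G w])
    show "continuous_map (subtopology (tuple_space X E n) (?T w)) Z (g w)"
      by (rule continuous_map_from_subtopology[OF g(1)[OF w]])
  next
    fix v w x
    assume vw: "v \<in> indep_tuples X E n" "w \<in> indep_tuples X E n"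
      and x: "x \<in> topspace (tuple_space X E n) \<inter> ?T v \<inter> ?T w"
    have "f x = g v x" using x by (intro g(2)[OF vw(1)]) (simp only: Int_iff)
    moreover have "f x = g w x" using x by (intro g(2)[OF vw(2)]) (simp only: Int_iff)
    ultimately show "g v x = g w x" by simp
  next
    fix x assume "x \<in> topspace (tuple_space X E n)"
    then have x: "x \<in> indep_tuples X E n" "x \<in> ?T x" by auto
    then show "\<exists>j. j \<in> indep_tuples X E n \<and> x \<in> ?T j \<and> f x = g j x"
      by (intro exI[of _ x] conjI g(2))
  qed
qed

text \<open>
  Since the dependent sets form an open set, \<^term>\<open>indep_space X E n\<close> also carries the
  quotient topology of the independent tuples.
\<close>

lemma openin_indep_space:
  assumes G: "topological_packing_graph X E" and W: "W \<subseteq> indep_le X E n"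
    and op: "openin (tuple_space X E n) {v \<in> indep_tuples X E n. v ` {..<n} \<in> W}"
  shows "openin (indep_space X E n) W"
proof -
  let ?P = "product_topology (\<lambda>_. X) {..<n}"
  let ?D = "sub_le n (topspace X) - indep_le X E n"
  obtain T where T: "openin ?P T" "{v \<in> indep_tuples X E n. v ` {..<n} \<in> W} = T \<inter> indep_tuples X E n"
    using op unfolding tuple_space_def openin_subtopology by blast
  have sub: "v ` {..<n} \<in> sub_le n (topspace X)" if "v \<in> topspace ?P" for v
    using that card_image_le[of "{..<n}" v] by (auto simp: sub_le_def PiE_def Pi_def)
  \<comment> \<open>Adding all dependent sets to \<open>W\<close> makes the preimage open in the
    full product: it becomes the union of the open set \<open>T\<close> and the open set of
    dependent tuples.\<close>
  have "{v \<in> topspace ?P. v ` {..<n} \<in> W \<union> ?D}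
      = T \<union> {v \<in> topspace ?P. \<not> indep (topspace X) E (v ` {..<n})}"
  proof (rule set_eqI)
    fix v
    show "v \<in> {v \<in> topspace ?P. v ` {..<n} \<in> W \<union> ?D} \<longleftrightarrow>
        v \<in> T \<union> {v \<in> topspace ?P. \<not> indep (topspace X) E (v ` {..<n})}"
    proof (cases "v \<in> topspace ?P")
      case v: True
      have D: "v ` {..<n} \<in> ?D \<longleftrightarrow> \<not> indep (topspace X) E (v ` {..<n})"
        using sub[OF v] by (auto simp: indep_le_def)
      show ?thesis
      proof (cases "indep (topspace X) E (v ` {..<n})")
        case True
        then have "v \<in> indep_tuples X E n" using v by (simp add: indep_tuples_def)
        then have "v ` {..<n} \<in> W \<longleftrightarrow> v \<in> T" using T(2) by blast
        then show ?thesis using v D True by (simp only: mem_Collect_eq Un_iff simp_thms)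
      next
        case False
        then show ?thesis using v D by (simp only: mem_Collect_eq Un_iff simp_thms)
      qed
    next
      case False
      then show ?thesis using openin_subset[OF T(1)] by blast
    qed
  qed
  then have "openin ?P {v \<in> topspace ?P. v ` {..<n} \<in> W \<union> ?D}"
    using openin_Un[OF T(1) openin_dependent_tuples[OF G]] by (simp only:)
  moreover have "W \<union> ?D \<subseteq> sub_le n (topspace X)" using W by (auto simp: indep_le_def)
  ultimately have "openin (sub_topology n X) (W \<union> ?D)"
    by (simp only: openin_sub_topology simp_thms)
  moreover have "W = (W \<union> ?D) \<inter> indep_le X E n" using W by blast
  ultimately show ?thesis unfolding indep_space_def openin_subtopology by blast
qed

text \<open>Universal property of the quotient. That \<open>f\<close> lands in
  \<open>topspace Z\<close> is a separate hypothesis because for \<open>n > 0\<close> the empty set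
  is the image of no tuple.\<close>

lemma continuous_map_indep_space:
  assumes G: "topological_packing_graph X E"
    and f: "f ` indep_le X E n \<subseteq> topspace Z"
    and cont: "continuous_map (tuple_space X E n) Z (\<lambda>v. f (v ` {..<n}))"
  shows "continuous_map (indep_space X E n) Z f"
  unfolding continuous_map_alt
proof (intro conjI allI impI)
  show "f \<in> topspace (indep_space X E n) \<rightarrow> topspace Z" using f by auto
  fix U assume "openin Z U"
  then have "openin (tuple_space X E n)
      {v \<in> topspace (tuple_space X E n). f (v ` {..<n}) \<in> U}"
    using cont by (rule openin_continuous_map_preimage[rotated])
  moreover have "{v \<in> topspace (tuple_space X E n). f (v ` {..<n}) \<in> U}
      = {v \<in> indep_tuples X E n. v ` {..<n} \<in> f -` U \<inter> indep_le X E n}"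
    using indep_tuples_image by auto
  ultimately show "openin (indep_space X E n) (f -` U \<inter> topspace (indep_space X E n))"
    using openin_indep_space[OF G] by simp
qed

text \<open>The map factors through tuples of length \<open>t\<close>: select coordinates by a
  surjection from \<open>{..<t}\<close> onto \<open>A\<close>, then apply the quotient map. For
  empty \<open>A\<close> the map is constant.\<close>

lemma continuous_map_subtuple:
  assumes A: "A \<subseteq> {..<n}" "card A \<le> t"
  shows "continuous_map (tuple_space X E n) (indep_space X E t) (\<lambda>v. v ` A)"
proof -
  let ?P = "\<lambda>k. product_topology (\<lambda>_. X) {..<k::nat}"
  have finA: "finite A" using A finite_subset by blast
  have img: "v ` A \<in> indep_le X E t" if "v \<in> indep_tuples X E n" for v
    using that A finA card_image_le[OF finA, of v] indep_subset[of "topspace X" E "v ` {..<n}" "v ` A"]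
    by (auto simp: indep_le_iff indep_tuples_def)
  have "continuous_map (tuple_space X E n) (sub_topology t X) (\<lambda>v. v ` A)"
  proof (cases "A = {}")
    case True
    then show ?thesis by (simp add: topspace_sub_topology sub_le_def)
  next
    case False
    obtain e0 where "bij_betw e0 {..<card A} A"
      using ex_bij_betw_nat_finite[OF finA] atLeast0LessThan by metis
    moreover obtain a where a: "a \<in> A" using False by blast
    ultimately obtain e where e: "e ` {..<t} = A"
    proof -
      assume bij: "bij_betw e0 {..<card A} A"
        and *: "\<And>e. e ` {..<t} = A \<Longrightarrow> thesis"
      have e0: "e0 ` {..<card A} = A" using bij by (simp add: bij_betw_def)
      \<comment> \<open>An enumeration of \<open>A\<close> is padded to length \<open>t\<close> by
        repeating the element \<open>a\<close>.\<close>
      have "(\<lambda>i. if i < card A then e0 i else a) ` {..<t} = A"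
      proof
        show "(\<lambda>i. if i < card A then e0 i else a) ` {..<t} \<subseteq> A" using e0 a by auto
        show "A \<subseteq> (\<lambda>i. if i < card A then e0 i else a) ` {..<t}"
        proof
          fix x assume "x \<in> A"
          then obtain i where "i < card A" "x = e0 i" using e0 by auto
          then show "x \<in> (\<lambda>i. if i < card A then e0 i else a) ` {..<t}"
            using A(2) by (intro image_eqI[of _ _ i]) auto
        qed
      qed
      then show thesis by (rule *)
    qed
    have en: "e i < n" if "i < t" for i using e A that by auto
    let ?c = "\<lambda>v :: nat \<Rightarrow> 'a. \<lambda>i\<in>{..<t}. v (e i)"
    have "continuous_map (tuple_space X E n) (?P t) ?c"
      unfolding continuous_map_componentwise tuple_space_def
      using en by (auto intro!: continuous_map_from_subtopology continuous_map_product_projection)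
    moreover have "continuous_map (?P t) (sub_topology t X) (\<lambda>v. v ` {..<t})"
      unfolding continuous_map_alt
    proof (intro conjI allI impI)
      show "(\<lambda>v. v ` {..<t}) \<in> topspace (?P t) \<rightarrow> topspace (sub_topology t X)"
        using card_image_le[of "{..<t}"]
        by (auto simp: topspace_sub_topology sub_le_def PiE_def Pi_def)
      fix U assume "openin (sub_topology t X) U"
      then show "openin (?P t) ((\<lambda>v. v ` {..<t}) -` U \<inter> topspace (?P t))"
        unfolding openin_sub_topology by (simp add: vimage_def Int_def conj_commute)
    qed
    ultimately have c: "continuous_map (tuple_space X E n) (sub_topology t X) ((\<lambda>v. v ` {..<t}) \<circ> ?c)"
      by (rule continuous_map_compose)
    have "((\<lambda>v. v ` {..<t}) \<circ> ?c) = (\<lambda>v. v ` A)"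
      using e by (auto simp: fun_eq_iff)
    with c show ?thesis by (simp only:)
  qed
  then show ?thesis
    unfolding indep_space_def continuous_map_in_subtopology using img by auto
qed

text \<open>The number of distinct entries of a tuple depends only on its coincidence pattern, which
  is locally constant.\<close>

lemma continuous_map_card_indep_space:
  assumes G: "topological_packing_graph X E"
  shows "continuous_map (indep_space X E n) (discrete_topology UNIV) card"
proof (rule continuous_map_indep_space[OF G])
  show "continuous_map (tuple_space X E n) (discrete_topology UNIV) (\<lambda>v. card (v ` {..<n}))"
  proof (rule continuous_map_tuple_space[OF G])
    fix w assume "w \<in> indep_tuples X E n"
    have card_eq: "card (v ` {..<n}) = card (w ` {..<n})"
      if pat: "\<forall>i<n. \<forall>j<n. v i = v j \<longleftrightarrow> w i = w j" for v :: "nat \<Rightarrow> 'a"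
    proof (rule bij_betw_same_card)
      \<comment> \<open>The bijection sends an entry of \<open>v\<close> to the entry of
        \<open>w\<close> at the same index; equality of the patterns makes the choice of index
        irrelevant.\<close>
      let ?h = "\<lambda>x. w (SOME i. i < n \<and> v i = x)"
      have h: "?h (v i) = w i" if "i < n" for i
      proof -
        have "(SOME k. k < n \<and> v k = v i) < n \<and> v (SOME k. k < n \<and> v k = v i) = v i"
          by (rule someI[of _ i]) (simp add: that)
        then show ?thesis using pat that by blast
      qed
      have "inj_on ?h (v ` {..<n})"
      proof (rule inj_onI)
        fix x y assume "x \<in> v ` {..<n}" "y \<in> v ` {..<n}" and eq: "?h x = ?h y"
        then obtain i j where ij: "i < n" "j < n" "x = v i" "y = v j" by blast
        then have "w i = w j" using eq h by metis
        then show "x = y" using ij pat by blast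
      qed
      moreover have "?h ` v ` {..<n} = w ` {..<n}"
        unfolding image_image using h by (intro image_cong) simp_all
      ultimately show "bij_betw ?h (v ` {..<n}) (w ` {..<n})" by (simp add: bij_betw_def)
    qed
    show "\<exists>g. continuous_map (tuple_space X E n) (discrete_topology UNIV) g \<and>
      (\<forall>v\<in>indep_tuples X E n. (\<forall>i<n. \<forall>j<n. v i = v j \<longleftrightarrow> w i = w j) \<longrightarrow> card (v ` {..<n}) = g v)"
      by (intro exI[of _ "\<lambda>_. card (w ` {..<n})"] conjI ballI impI card_eq) simp_all
  qed
qed simp

lemma openin_indep_eq:
  assumes G: "topological_packing_graph X E" and sub: "indep_eq X E k \<subseteq> indep_le X E n"
  shows "openin (indep_space X E n) (indep_eq X E k)"
proof -
  have "openin (indep_space X E n) {S \<in> topspace (indep_space X E n). card S \<in> {k}}"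
    by (rule openin_continuous_map_preimage[OF continuous_map_card_indep_space[OF G]]) simp
  moreover have "{S \<in> topspace (indep_space X E n). card S \<in> {k}} = indep_eq X E k"
    using sub by (auto simp: indep_eq_def indep_le_iff)
  ultimately show ?thesis by simp
qed


section \<open>The operator and its adjoint\<close>

lemma continuous_map_A_op:
  assumes G: "topological_packing_graph X E"
    and K: "continuous_map (prod_topology (indep_space X E t) (indep_space X E t)) euclideanreal K"
  shows "continuous_map (indep_space X E n) euclideanreal (A_op X E t K)"
proof (rule continuous_map_indep_space[OF G])
  show "continuous_map (tuple_space X E n) euclideanreal (\<lambda>v. A_op X E t K (v ` {..<n}))"
  proof (rule continuous_map_tuple_space[OF G])
    fix w assume "w \<in> indep_tuples X E n"
    \<comment> \<open>\<open>R\<close> holds the least index of each class of equal entries: every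
      tuple with the pattern of \<open>w\<close> is injective on \<open>R\<close> and takes all its
      values there.\<close>
    define R where "R = {i. i < n \<and> (\<forall>j<i. w j \<noteq> w i)}"
    \<comment> \<open>The index version of the summation range of \<open>A_op\<close>; the
      cardinality bounds carry over because the tuples are injective on \<open>R\<close>.\<close>
    define Q where "Q = {(A, B). A \<union> B = R \<and> card A \<le> t \<and> card B \<le> t}"
    let ?g = "\<lambda>v. \<Sum>(A, B)\<in>Q. K (v ` A, v ` B)"
    have R: "R \<subseteq> {..<n}" "finite R" by (auto simp: R_def)
    have "Q \<subseteq> Pow R \<times> Pow R" by (auto simp: Q_def)
    then have finQ: "finite Q" using R by (meson finite_Pow_iff finite_SigmaI finite_subset)
    have wR: "\<exists>j\<in>R. w j = w i" if "i < n" for i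
    proof -
      obtain j where j: "w j = w i" "\<And>k. k < j \<Longrightarrow> w k \<noteq> w i"
        using exists_least_iff[of "\<lambda>j. w j = w i"] by blast
      then have "j \<le> i" by (metis not_le)
      then have "j \<in> R" unfolding R_def using j that by simp
      with j(1) show ?thesis by blast
    qed
    have "continuous_map (tuple_space X E n) euclideanreal (\<lambda>v. K (v ` A, v ` B))"
      if "(A, B) \<in> Q" for A B
    proof -
      have AB: "A \<subseteq> {..<n}" "B \<subseteq> {..<n}" "card A \<le> t" "card B \<le> t"
        using that R by (auto simp: Q_def)
      have "continuous_map (tuple_space X E n)
          (prod_topology (indep_space X E t) (indep_space X E t)) (\<lambda>v. (v ` A, v ` B))"
        using AB by (simp add: continuous_map_pairwise o_def continuous_map_subtuple)
      from continuous_map_compose[OF this K] show ?thesis by (simp add: o_def)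
    qed
    then have "continuous_map (tuple_space X E n) euclideanreal ?g"
      using finQ by (intro continuous_map_sum) auto
    moreover have "A_op X E t K (v ` {..<n}) = ?g v"
      if v: "v \<in> indep_tuples X E n" and pat: "\<forall>i<n. \<forall>j<n. v i = v j \<longleftrightarrow> w i = w j" for v
    proof -
      have inj: "inj_on v R"
      proof (rule inj_onI)
        fix i j assume ij: "i \<in> R" "j \<in> R" "v i = v j"
        then have "w i = w j" using pat by (auto simp: R_def)
        with ij show "i = j" unfolding R_def
          by (metis (mono_tags, lifting) linorder_neqE_nat mem_Collect_eq)
      qed
      have "v i \<in> v ` R" if i: "i < n" for i
      proof -
        obtain j where "j \<in> R" "w j = w i" using wR[OF i] by blast
        then have "v j = v i" using pat i R by auto
        then show ?thesis using \<open>j \<in> R\<close> by (metis imageI)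
      qed
      then have vR: "v ` {..<n} = v ` R" using R by blast
      have ind: "indep (topspace X) E (v ` R)" using v vR by (simp add: indep_tuples_def)
      let ?h = "\<lambda>(A, B). (v ` A, v ` B)"
      have im: "?h ` Q = {(J, J'). J \<in> indep_le X E t \<and> J' \<in> indep_le X E t \<and> J \<union> J' = v ` R}"
        (is "_ = ?S")
      proof
        show "?h ` Q \<subseteq> ?S"
        proof clarify
          fix A B assume "(A, B) \<in> Q"
          then have AB: "A \<union> B = R" "card A \<le> t" "card B \<le> t" by (auto simp: Q_def)
          then have fin: "finite A" "finite B" using R by auto
          have "indep (topspace X) E (v ` A)" "indep (topspace X) E (v ` B)"
            using indep_subset[OF ind] AB by blast+
          moreover have "v ` A \<union> v ` B = v ` R" using AB by (metis image_Un)
          ultimately show "v ` A \<in> indep_le X E t \<and> v ` B \<in> indep_le X E t \<and> v ` A \<union> v ` B = v ` R"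
            using AB fin card_image_le[OF fin(1), of v] card_image_le[OF fin(2), of v]
            by (simp add: indep_le_iff)
        qed
        show "?S \<subseteq> ?h ` Q"
        proof clarify
          fix J J' assume J: "J \<in> indep_le X E t" "J' \<in> indep_le X E t" "J \<union> J' = v ` R"
          obtain A where A: "A \<subseteq> R" "J = v ` A" using J(3) by (metis Un_upper1 subset_imageE)
          obtain B where B: "B \<subseteq> R" "J' = v ` B" using J(3) by (metis Un_upper2 subset_imageE)
          have "v ` (A \<union> B) = v ` R" using A B J by (simp add: image_Un)
          then have "A \<union> B = R" using inj A B by (simp add: inj_on_image_eq_iff)
          moreover have "card A = card J" "card B = card J'"
            using A B inj by (metis card_image inj_on_subset)+
          ultimately have "(A, B) \<in> Q" using J by (simp add: Q_def indep_le_iff)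
          then show "(J, J') \<in> ?h ` Q" using A B by (auto intro!: image_eqI[of _ _ "(A, B)"])
        qed
      qed
      have injh: "inj_on ?h Q"
      proof (rule inj_onI, clarify)
        fix A B A' B' assume "(A, B) \<in> Q" "(A', B') \<in> Q" and eq: "v ` A = v ` A'" "v ` B = v ` B'"
        then have "A \<subseteq> R" "A' \<subseteq> R" "B \<subseteq> R" "B' \<subseteq> R" by (auto simp: Q_def)
        with eq show "A = A' \<and> B = B'" using inj by (simp add: inj_on_image_eq_iff)
      qed
      have "A_op X E t K (v ` {..<n}) = (\<Sum>p\<in>?h ` Q. K p)"
        unfolding A_op_def vR im by (intro sum.cong) auto
      also have "\<dots> = ?g v"
        unfolding sum.reindex[OF injh] by (intro sum.cong) auto
      finally show ?thesis .
    qed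
    ultimately show "\<exists>g. continuous_map (tuple_space X E n) euclideanreal g \<and>
      (\<forall>v\<in>indep_tuples X E n. (\<forall>i<n. \<forall>j<n. v i = v j \<longleftrightarrow> w i = w j) \<longrightarrow>
        A_op X E t K (v ` {..<n}) = g v)"
      by blast
  qed
qed simp

text \<open>Each pair of subsets of \<open>S\<close> is counted exactly once, at its union. All of
  these subsets lie in \<open>indep_le X E t\<close> because \<open>S\<close> does. This computes
  the integral against point masses on \<open>Pow S\<close> and also drives the Moebius inversion
  below.\<close>

lemma sum_A_op_Pow:
  assumes S: "S \<in> indep_le X E t"
  shows "(\<Sum>R\<in>Pow S. A_op X E t K R) = (\<Sum>p\<in>Pow S \<times> Pow S. K p)"
proof -
  have sub: "T \<in> indep_le X E t" if "T \<subseteq> S" for T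
    using S that indep_subset[of "topspace X" E S T] card_mono[of S T] finite_subset[of T S]
    by (auto simp: indep_le_iff)
  have fin: "finite (Pow S)" using S by (simp add: indep_le_iff)
  have A_op: "A_op X E t K R = (\<Sum>p\<in>{p. p \<in> Pow S \<times> Pow S \<and> fst p \<union> snd p = R}. K p)"
    if "R \<in> Pow S" for R
  proof -
    have "{(J, J'). J \<in> indep_le X E t \<and> J' \<in> indep_le X E t \<and> J \<union> J' = R}
        = {p. p \<in> Pow S \<times> Pow S \<and> fst p \<union> snd p = R}"
      using that sub by auto
    then show ?thesis unfolding A_op_def by (auto intro!: sum.cong)
  qed
  have "(\<Sum>R\<in>Pow S. A_op X E t K R)
      = (\<Sum>R\<in>Pow S. \<Sum>p\<in>{p. p \<in> Pow S \<times> Pow S \<and> fst p \<union> snd p = R}. K p)"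
    by (intro sum.cong refl A_op)
  also have "\<dots> = (\<Sum>p\<in>Pow S \<times> Pow S. K p)"
    using fin by (intro sum.group) auto
  finally show ?thesis .
qed


section \<open>A kernel depending on cardinalities\<close>

lemma sum_Pow_insert:
  assumes "finite S" "x \<notin> S"
  shows "(\<Sum>J\<in>Pow (insert x S). g J) = (\<Sum>J\<in>Pow S. g J + g (insert x J))"
proof -
  have "inj_on (insert x) (Pow S)" using assms(2) by (auto simp: inj_on_def)
  moreover have "Pow S \<inter> insert x ` Pow S = {}" using assms(2) by auto
  ultimately show ?thesis
    using assms(1) by (simp add: Pow_insert sum.union_disjoint sum.reindex sum.distrib)
qed

text \<open>Induction on \<open>S\<close>: pairing \<open>J\<close> with \<open>insert x J\<close>
  leaves a difference of binomial coefficients, which is 0 for \<open>s = 0\<close> and, by Pascal's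
  rule, minus the coefficient for \<open>s - 1\<close> otherwise.\<close>

lemma alternating_sum_Pow_choose:
  assumes "finite S"
  shows "(\<Sum>J\<in>Pow S. (- 1) ^ card J * real (card J choose s))
    = (if card S = s then (- 1) ^ s else 0)"
  using assms
proof (induction S arbitrary: s rule: finite_induct)
  case empty
  then show ?case by (cases s) auto
next
  case (insert x S)
  have card: "card (insert x J) = Suc (card J)" if "J \<in> Pow S" for J
    using that insert.hyps by (meson PowD card_insert_disjoint finite_subset subsetD)
  have "(\<Sum>J\<in>Pow (insert x S). (- 1) ^ card J * real (card J choose s))
      = (\<Sum>J\<in>Pow S. (- 1) ^ card J * (real (card J choose s) - real (Suc (card J) choose s)))"
    unfolding sum_Pow_insert[OF insert.hyps] using card
    by (intro sum.cong refl) (simp add: algebra_simps)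
  also have "\<dots> = (if card (insert x S) = s then (- 1) ^ s else 0)"
  proof (cases s)
    case 0
    then show ?thesis using insert.hyps by simp
  next
    case (Suc r)
    have "(\<Sum>J\<in>Pow S. (- 1) ^ card J * (real (card J choose s) - real (Suc (card J) choose s)))
        = - (\<Sum>J\<in>Pow S. (- 1) ^ card J * real (card J choose r))"
      unfolding sum_negf[symmetric] by (intro sum.cong refl) (simp add: Suc)
    then show ?thesis using insert.IH[of r] insert.hyps Suc by simp
  qed
  finally show ?case .
qed

text \<open>
  By the previous lemma, the sum of \<^term>\<open>(- 1) ^ (card J + s) * real (card J choose s)\<close> over
  \<^term>\<open>J \<in> Pow S\<close> is 1 if \<^term>\<open>card S = s\<close> and 0 otherwise; the sign \<^term>\<open>(- 1) ^ s\<close>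
  occurs twice in the kernel and cancels.
\<close>

definition card_kernel :: "nat \<Rightarrow> 'a set \<times> 'a set \<Rightarrow> real" where
  "card_kernel a = (\<lambda>(J, J'). \<Sum>s\<le>a. (real a - real s) *
     (((- 1) ^ card J * real (card J choose s)) * ((- 1) ^ card J' * real (card J' choose s))))"

text \<open>For each \<open>s\<close> the double sum factors into the square of an alternating sum,
  which is 1 if \<open>card S = s\<close> and 0 otherwise. The surviving index lies in the range
  because \<open>card S \<le> a\<close>.\<close>

lemma sum_card_kernel:
  assumes "finite S" "card S \<le> a"
  shows "(\<Sum>p\<in>Pow S \<times> Pow S. card_kernel a p) = real a - real (card S)"
proof -
  let ?c = "\<lambda>s J. (- 1) ^ card J * real (card J choose s)"
  have "(\<Sum>p\<in>Pow S \<times> Pow S. card_kernel a p)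
      = (\<Sum>J\<in>Pow S. \<Sum>J'\<in>Pow S. \<Sum>s\<le>a. (real a - real s) * (?c s J * ?c s J'))"
    by (subst sum.cartesian_product) (auto simp: card_kernel_def intro!: sum.cong)
  also have "\<dots> = (\<Sum>J\<in>Pow S. \<Sum>s\<le>a. \<Sum>J'\<in>Pow S. (real a - real s) * (?c s J * ?c s J'))"
    by (intro sum.cong refl sum.swap)
  also have "\<dots> = (\<Sum>s\<le>a. \<Sum>J\<in>Pow S. \<Sum>J'\<in>Pow S. (real a - real s) * (?c s J * ?c s J'))"
    by (rule sum.swap)
  also have "\<dots> = (\<Sum>s\<le>a. (real a - real s) * ((\<Sum>J\<in>Pow S. ?c s J) * (\<Sum>J'\<in>Pow S. ?c s J')))"
    unfolding sum_product by (simp only: sum_distrib_left)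
  also have "\<dots> = (\<Sum>s\<le>a. if s = card S then real a - real s else 0)"
    unfolding alternating_sum_Pow_choose[OF assms(1)]
    by (intro sum.cong refl) (simp flip: power_add mult_2)
  also have "\<dots> = real a - real (card S)"
    using assms(2) by (simp add: sum.delta)
  finally show ?thesis .
qed

text \<open>The kernel is a combination of rank-one kernels with weights \<open>a - s\<close>,
  nonnegative for \<open>s \<le> a\<close>. The factors are continuous because they are functions of
  the cardinality.\<close>

lemma card_kernel_psd:
  fixes X :: "'a topology"
  assumes G: "topological_packing_graph X E"
  shows "card_kernel a \<in> psd_kernels (indep_space X E t)"
proof -
  let ?Y = "indep_space X E t"
  let ?c = "\<lambda>s (J :: 'a set). (- 1) ^ card J * real (card J choose s)"
  have c: "continuous_map ?Y euclideanreal (?c s)" for s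
    using continuous_map_compose[OF continuous_map_card_indep_space[OF G],
        of euclideanreal "\<lambda>j. (- 1) ^ j * real (j choose s)"]
    by (simp add: o_def)
  have "continuous_map (prod_topology ?Y ?Y) euclideanreal
     (\<lambda>p. \<Sum>s\<le>a. (real a - real s) * (?c s (fst p) * ?c s (snd p)))"
  proof (intro continuous_map_sum)
    fix s
    have 1: "continuous_map (prod_topology ?Y ?Y) euclideanreal (\<lambda>p. ?c s (fst p))"
      using continuous_map_compose[OF continuous_map_fst c] by (simp add: o_def)
    have 2: "continuous_map (prod_topology ?Y ?Y) euclideanreal (\<lambda>p. ?c s (snd p))"
      using continuous_map_compose[OF continuous_map_snd c] by (simp add: o_def)
    show "continuous_map (prod_topology ?Y ?Y) euclideanreal
        (\<lambda>p. (real a - real s) * (?c s (fst p) * ?c s (snd p)))"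
      by (rule continuous_map_real_mult_left[OF continuous_map_real_mult[OF 1 2]])
  qed simp
  also have "(\<lambda>p. \<Sum>s\<le>a. (real a - real s) * (?c s (fst p) * ?c s (snd p))) = card_kernel a"
    by (auto simp: card_kernel_def)
  finally have "continuous_map (prod_topology ?Y ?Y) euclideanreal (card_kernel a)" .
  moreover have "card_kernel a (x, y) = card_kernel a (y, x)" for x y :: "'a set"
    unfolding card_kernel_def by (simp add: mult_ac)
  moreover have "0 \<le> (\<Sum>i<m. \<Sum>j<m. d i * card_kernel a (x i, x j) * d j)"
    for m :: nat and x :: "nat \<Rightarrow> 'a set" and d :: "nat \<Rightarrow> real"
  proof -
    have "(\<Sum>i<m. \<Sum>j<m. d i * card_kernel a (x i, x j) * d j)
        = (\<Sum>i<m. \<Sum>j<m. \<Sum>s\<le>a. (real a - real s) * ((d i * ?c s (x i)) * (d j * ?c s (x j))))"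
      unfolding card_kernel_def
      by (simp add: sum_distrib_left sum_distrib_right mult_ac)
    also have "\<dots> = (\<Sum>i<m. \<Sum>s\<le>a. \<Sum>j<m. (real a - real s) * ((d i * ?c s (x i)) * (d j * ?c s (x j))))"
      by (intro sum.cong refl sum.swap)
    also have "\<dots> = (\<Sum>s\<le>a. \<Sum>i<m. \<Sum>j<m. (real a - real s) * ((d i * ?c s (x i)) * (d j * ?c s (x j))))"
      by (rule sum.swap)
    \<comment> \<open>The quadratic form is now a weighted sum of squares.\<close>
    also have "\<dots> = (\<Sum>s\<le>a. (real a - real s) *
        ((\<Sum>i<m. d i * ?c s (x i)) * (\<Sum>j<m. d j * ?c s (x j))))"
      unfolding sum_product by (simp only: sum_distrib_left)
    also have "\<dots> \<ge> 0" by (intro sum_nonneg mult_nonneg_nonneg zero_le_square) simp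
    finally show ?thesis .
  qed
  ultimately show ?thesis by (simp add: psd_kernels_def sym_kernels_def)
qed

text \<open>Moebius inversion of \<^term>\<open>\<lambda>S. real a - real (card S)\<close> over the subsets of \<^term>\<open>S\<close>.\<close>

lemma A_op_card_kernel:
  assumes "S \<in> indep_le X E a"
  shows "A_op X E a (card_kernel a) S = (if S = {} then real a else 0) - (if card S = 1 then 1 else 0)"
proof -
  let ?h = "\<lambda>S :: 'a set. (if S = {} then real a else 0) - (if card S = 1 then 1 else 0)"
  have "finite S" using assms by (simp add: indep_le_iff)
  then show ?thesis using assms
  proof (induction S rule: finite_psubset_induct)
    case (psubset S)
    have fin: "finite (Pow S)" using psubset.hyps by simp
    have sub: "R \<in> indep_le X E a" if "R \<subseteq> S" for R
      using psubset that indep_subset[of "topspace X" E S R] card_mono[of S R] finite_subset[of R S]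
      by (auto simp: indep_le_iff)
    have IH: "A_op X E a (card_kernel a) R = ?h R" if "R \<in> Pow S - {S}" for R
      using that by (intro psubset.IH sub) auto
    have "Pow S \<inter> {R. card R = 1} = {R. R \<subseteq> S \<and> card R = 1}" by auto
    then have "(\<Sum>R\<in>Pow S. ?h R) = real a - real (card S)"
      using fin n_subsets[OF psubset.hyps, of 1]
      by (simp add: sum_subtractf sum.delta sum.If_cases)
    also have "\<dots> = (\<Sum>R\<in>Pow S. A_op X E a (card_kernel a) R)"
      using psubset.prems by (simp add: sum_A_op_Pow sum_card_kernel indep_le_iff)
    \<comment> \<open>Both functions have the same sum over \<open>Pow S\<close>. The terms at
      proper subsets agree by induction, so the terms at \<open>S\<close> agree as well.\<close>
    finally have "?h S + (\<Sum>R\<in>Pow S - {S}. ?h R)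
        = A_op X E a (card_kernel a) S + (\<Sum>R\<in>Pow S - {S}. A_op X E a (card_kernel a) R)"
      using fin by (simp only: sum.remove[of "Pow S" S] Pow_top)
    moreover have "(\<Sum>R\<in>Pow S - {S}. A_op X E a (card_kernel a) R) = (\<Sum>R\<in>Pow S - {S}. ?h R)"
      by (intro sum.cong refl IH)
    ultimately show ?case by simp
  qed
qed


section \<open>The independence number\<close>

text \<open>By compactness finitely many open cliques cover the vertices, and an independent set has
  at most one point in each of them.\<close>

lemma indep_card_bounded:
  assumes "compact_topological_packing_graph X E"
  obtains N where "\<And>S. indep (topspace X) E S \<Longrightarrow> finite S \<and> card S \<le> N"
proof -
  have G: "topological_packing_graph X E" and comp: "compact_space X"
    using assms by (auto simp: compact_topological_packing_graph_def)
  have cover: "\<exists>U. openin X U \<and> clique (topspace X) E U \<and> x \<in> U" if "x \<in> topspace X" for x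
  proof -
    have "finite {x} \<and> clique (topspace X) E {x}" using that by (simp add: clique_def)
    then show ?thesis using G unfolding topological_packing_graph_def by (meson insert_subset)
  qed
  let ?\<U> = "{U. openin X U \<and> clique (topspace X) E U}"
  have "\<forall>U\<in>?\<U>. openin X U" "topspace X \<subseteq> \<Union>?\<U>" using cover by blast+
  then obtain \<F> where F: "finite \<F>" "\<F> \<subseteq> ?\<U>" "topspace X \<subseteq> \<Union>\<F>"
    using comp unfolding compact_space_alt by meson
  have "finite S \<and> card S \<le> card \<F>" if S: "indep (topspace X) E S" for S
  proof -
    have "\<forall>x\<in>S. \<exists>U. U \<in> \<F> \<and> x \<in> U" using S F(3) by (auto simp: indep_def)
    then obtain u where u: "\<forall>x\<in>S. u x \<in> \<F> \<and> x \<in> u x" by metis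
    have "inj_on u S"
    proof (rule inj_onI, rule ccontr)
      fix x y assume xy: "x \<in> S" "y \<in> S" "u x = u y" "x \<noteq> y"
      then have "clique (topspace X) E (u x)" "x \<in> u x" "y \<in> u x" using u F(2) by auto
      then have "{x, y} \<in> E" using xy by (simp add: clique_def)
      then have "\<not> {x, y} \<subseteq> S" using S unfolding indep_def by blast
      then show False using xy by simp
    qed
    moreover have "u ` S \<subseteq> \<F>" using u by blast
    ultimately show ?thesis by (intro conjI inj_on_finite[OF _ _ F(1)] card_inj_on_le[OF _ _ F(1)])
  qed
  then show thesis by (rule that)
qed

lemma indep_number_attained:
  assumes "compact_topological_packing_graph X E"
  obtains S where "indep (topspace X) E S" "finite S"
    "indep_number (topspace X) E = enat (card S)"
    "\<And>T. indep (topspace X) E T \<Longrightarrow> finite T \<and> card T \<le> card S"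
proof -
  let ?I = "{S. indep (topspace X) E S}"
  obtain N where N: "\<And>S. indep (topspace X) E S \<Longrightarrow> finite S \<and> card S \<le> N"
    using indep_card_bounded[OF assms] by blast
  have fin: "finite (card ` ?I)" by (rule finite_subset[of _ "{..N}"]) (use N in auto)
  have "graph (topspace X) E"
    using assms by (simp add: compact_topological_packing_graph_def topological_packing_graph_def)
  \<comment> \<open>Edges have two elements, so none is contained in \<open>{}\<close>; this makes
    the set of cardinalities nonempty and its maximum meaningful.\<close>
  then have "indep (topspace X) E {}" by (auto simp: indep_def graph_def)
  then have "card ` ?I \<noteq> {}" by auto
  from Max_in[OF fin this] obtain S where S: "indep (topspace X) E S" "card S = Max (card ` ?I)"
    by force
  have max: "card T \<le> card S" if "indep (topspace X) E T" for T
    unfolding S(2) using fin that by (intro Max_ge) auto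
  have "indep_number (topspace X) E \<le> enat (card S)"
    unfolding indep_number_def using N max by (intro SUP_least) auto
  moreover have "enat (card S) \<le> indep_number (topspace X) E"
    unfolding indep_number_def using S N by (intro SUP_upper2[of S]) auto
  ultimately show thesis using that[of S] S N max by (meson order_antisym)
qed

section \<open>The upper and the lower bound\<close>

lemma psd_kernels_sum_nonneg:
  assumes K: "K \<in> psd_kernels Y" and F: "finite F" "F \<subseteq> topspace Y"
  shows "0 \<le> (\<Sum>p\<in>F \<times> F. K p)"
proof -
  \<comment> \<open>The matrix condition is applied to an enumeration of \<open>F\<close> with all
    coefficients equal to 1.\<close>
  obtain x where x: "bij_betw x {..<card F} F"
    using ex_bij_betw_nat_finite[OF F(1)] atLeast0LessThan by metis
  then have "\<forall>i<card F. x i \<in> topspace Y" using F(2) by (auto simp: bij_betw_def)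
  then have "0 \<le> (\<Sum>i<card F. \<Sum>j<card F. 1 * K (x i, x j) * 1)"
    using K unfolding psd_kernels_def by (simp only: mem_Collect_eq)
  also have "\<dots> = (\<Sum>i<card F. \<Sum>q\<in>F. K (x i, q))"
    using sum.reindex_bij_betw[OF x, of "\<lambda>q. K (x i, q)" for i] by simp
  also have "\<dots> = (\<Sum>p\<in>F. \<Sum>q\<in>F. K (p, q))"
    by (rule sum.reindex_bij_betw[OF x])
  also have "\<dots> = (\<Sum>p\<in>F \<times> F. K p)"
    by (simp add: sum.cartesian_product)
  finally show ?thesis .
qed

text \<open>Testing the positive semidefinite \<open>\<mu>\<close> against
  \<open>card_kernel a\<close> gives a nonnegative number, which by adjointness equals
  \<open>a * \<nu> {{}} - \<nu> (indep_eq X E 1)\<close>.\<close>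

lemma las_feasible_le:
  assumes G: "topological_packing_graph X E"
    and bound: "\<And>T. indep (topspace X) E T \<Longrightarrow> finite T \<and> card T \<le> a"
    and \<nu>: "\<nu> \<in> las_feasible X E a"
  shows "\<nu> (indep_eq X E 1) \<le> real a"
proof -
  let ?Y = "indep_space X E a" and ?Z = "indep_space X E (2 * a)"
  obtain \<mu> where rad: "\<nu> \<in> nonneg_radon_measures ?Z" and "\<nu> {{}} = 1"
    and adj: "is_A_adjoint X E a \<nu> \<mu>" and psd: "\<mu> \<in> psd_measures ?Y"
    using \<nu> by (auto simp: las_feasible_def)
  have K: "card_kernel a \<in> psd_kernels ?Y" by (rule card_kernel_psd[OF G])
  have ind: "indep (topspace X) E {}"
    using G by (auto simp: topological_packing_graph_def graph_def indep_def)
  have "{{}} \<in> borel_sets ?Z"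
    using G ind by (intro finite_borel_sets t1_space_indep_space)
      (auto simp: topological_packing_graph_def indep_le_iff)
  moreover have "indep_eq X E 1 \<in> borel_sets ?Z"
    using bound by (intro openin_borel_sets openin_indep_eq[OF G] indep_eq_subset_indep_le) auto
  \<comment> \<open>The Boolean index writes the two-term step function in the form expected by
    \<open>radon_integral_indicator\<close>.\<close>
  moreover have "A_op X E a (card_kernel a) S = (\<Sum>b\<in>UNIV. (if b then real a else - 1) *
      indicator (if b then {{}} else indep_eq X E 1) S)" if "S \<in> topspace ?Z" for S
  proof -
    \<comment> \<open>Although \<open>?Z\<close> allows \<open>2 * a\<close> elements, independent
      sets have at most \<open>a\<close>, so the formula for \<open>A_op\<close> holds on the whole
      space.\<close>
    have "indep (topspace X) E S" using that by (simp add: indep_le_iff)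
    then have "S \<in> indep_le X E a" "S \<in> indep_eq X E 1 \<longleftrightarrow> card S = 1"
      using bound by (auto simp: indep_le_iff indep_eq_def)
    then show ?thesis by (simp add: A_op_card_kernel UNIV_bool indicator_def)
  qed
  ultimately have "radon_integral ?Z \<nu> (A_op X E a (card_kernel a))
      = (\<Sum>b\<in>UNIV. (if b then real a else - 1) * \<nu> (if b then {{}} else indep_eq X E 1))"
    by (intro radon_integral_indicator[OF rad]) (auto split: if_splits)
  also have "\<dots> = real a - \<nu> (indep_eq X E 1)"
    using \<open>\<nu> {{}} = 1\<close> by (simp add: UNIV_bool)
  finally have "radon_integral (prod_topology ?Y ?Y) \<mu> (card_kernel a) = real a - \<nu> (indep_eq X E 1)"
    using adj K by (simp add: is_A_adjoint_def psd_kernels_def)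
  moreover have "0 \<le> radon_integral (prod_topology ?Y ?Y) \<mu> (card_kernel a)"
    using psd K by (simp add: psd_measures_def)
  ultimately show ?thesis by simp
qed

text \<open>The image under the adjoint is the counting measure of
  \<open>Pow S \<times> Pow S\<close>, because both integrals equal the sum of \<open>K\<close> over
  these pairs. That sum is nonnegative for positive semidefinite \<open>K\<close>.\<close>

lemma counting_Pow_las_feasible:
  assumes G: "topological_packing_graph X E" and S: "S \<in> indep_le X E t"
  shows "counting (indep_space X E (2 * t)) (Pow S) \<in> las_feasible X E t"
proof -
  let ?Y = "indep_space X E t" and ?Z = "indep_space X E (2 * t)"
  let ?P = "prod_topology ?Y ?Y" and ?F = "Pow S \<times> Pow S"
  let ?\<nu> = "counting ?Z (Pow S)" and ?\<mu> = "counting ?P ?F"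
  have t1: "t1_space ?Y" "t1_space ?Z" "t1_space ?P"
    using G by (auto simp: topological_packing_graph_def t1_space_prod_topology
        intro!: t1_space_indep_space)
  have fin: "finite (Pow S)" "finite ?F" using S by (auto simp: indep_le_iff)
  have "T \<in> indep_le X E t" if "T \<subseteq> S" for T
    using S that indep_subset[of "topspace X" E S T] card_mono[of S T] finite_subset[of T S]
    by (auto simp: indep_le_iff)
  then have Y: "Pow S \<subseteq> topspace ?Y" by auto
  moreover have "indep_le X E t \<subseteq> indep_le X E (2 * t)" by (auto simp: indep_le_iff)
  ultimately have Z: "Pow S \<subseteq> topspace ?Z" by auto
  have P: "?F \<subseteq> topspace ?P" using Y by auto
  have sym: "?\<mu> \<in> sym_measures ?Y"
  proof -
    \<comment> \<open>On rectangles the count is the product of the counts in \<open>A\<close> and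
      \<open>B\<close>, hence symmetric.\<close>
    have "?\<mu> (A \<times> B) = ?\<mu> (B \<times> A)" if "A \<in> borel_sets ?Y" "B \<in> borel_sets ?Y" for A B
      using that fin
      by (simp add: counting_eq_card Times_borel_sets Times_Int_Times card_cartesian_product mult.commute)
    then show ?thesis
      using counting_nonneg_radon[OF t1(3) fin(2) P]
      by (simp add: sym_measures_def nonneg_radon_measures_def)
  qed
  have int: "radon_integral ?P ?\<mu> K = (\<Sum>p\<in>?F. K p)" if "K \<in> sym_kernels ?Y" for K
    using that by (intro radon_integral_counting t1 fin P) (simp add: sym_kernels_def)
  have "radon_integral ?Z ?\<nu> (A_op X E t K) = (\<Sum>p\<in>?F. K p)" if "K \<in> sym_kernels ?Y" for K
  proof -
    have "continuous_map ?Z euclideanreal (A_op X E t K)"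
      using that by (intro continuous_map_A_op[OF G]) (simp add: sym_kernels_def)
    then have "radon_integral ?Z ?\<nu> (A_op X E t K) = (\<Sum>R\<in>Pow S. A_op X E t K R)"
      by (rule radon_integral_counting[OF t1(2) fin(1) Z])
    then show ?thesis using sum_A_op_Pow[OF S] by simp
  qed
  then have "is_A_adjoint X E t ?\<nu> ?\<mu>" using sym int by (simp add: is_A_adjoint_def)
  moreover have "?\<mu> \<in> psd_measures ?Y"
    using sym int psd_kernels_sum_nonneg[OF _ fin(1) Y] by (simp add: psd_measures_def psd_kernels_def)
  moreover have "?\<nu> {{}} = 1"
  proof -
    have "{{}} \<in> borel_sets ?Z" using Z by (intro finite_borel_sets t1) auto
    then show ?thesis using fin(1) by (simp add: counting_eq_card)
  qed
  ultimately show ?thesis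
    using counting_nonneg_radon[OF t1(2) fin(1) Z] unfolding las_feasible_def by blast
qed

theorem theorem2:
  fixes X :: "'a topology" and E :: "'a set set"
  assumes "compact_topological_packing_graph X E"
  shows "las X E (the_enat (indep_number (topspace X) E)) =
         ereal_of_enat (indep_number (topspace X) E)"
proof -
  have G: "topological_packing_graph X E"
    using assms by (simp add: compact_topological_packing_graph_def)
  obtain S where S: "indep (topspace X) E S" "finite S"
    and num: "indep_number (topspace X) E = enat (card S)"
    and max: "\<And>T. indep (topspace X) E T \<Longrightarrow> finite T \<and> card T \<le> card S"
    using indep_number_attained[OF assms] by blast
  let ?a = "card S"
  let ?Z = "indep_space X E (2 * ?a)"
  have "las X E ?a \<le> ereal (real ?a)"
    unfolding las_def using las_feasible_le[OF G max] by (intro SUP_least) simp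
  moreover have "ereal (real ?a) \<le> las X E ?a"
  proof -
    \<comment> \<open>\<open>counting\<close> is 0 off the Borel sets, so measurability comes first.
      The value is then the number of one-element subsets of \<open>S\<close>.\<close>
    have "indep_eq X E 1 \<in> borel_sets ?Z"
      using max by (intro openin_borel_sets openin_indep_eq[OF G] indep_eq_subset_indep_le) auto
    then have "counting ?Z (Pow S) (indep_eq X E 1) = real (card (indep_eq X E 1 \<inter> Pow S))"
      using S by (intro counting_eq_card) auto
    also have "indep_eq X E 1 \<inter> Pow S = {R. R \<subseteq> S \<and> card R = 1}"
      using S indep_subset[of "topspace X" E S] by (auto simp: indep_eq_def intro: finite_subset)
    also have "real (card \<dots>) = real ?a"
      using n_subsets[OF S(2), of 1] by simp
    finally have "counting ?Z (Pow S) (indep_eq X E 1) = real ?a" .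
    moreover have "counting ?Z (Pow S) \<in> las_feasible X E ?a"
      using S by (intro counting_Pow_las_feasible[OF G]) (simp add: indep_le_iff)
    ultimately show ?thesis
      unfolding las_def by (metis SUP_upper)
  qed
  ultimately show ?thesis unfolding num by (simp add: order_antisym)
qed

end
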